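(* Let $S=\{s_1,\dots,s_k\}$ be a finite set, let $E\subseteq F_S$, let $\Gamma=\langle S\mid E\rangle$, and let $\nu\colon\mathbb{R}_{>0}\times\mathbb{N}\to\mathbb{N}\cup\{0,\infty\}$ be a function that is monotone non-decreasing in the first argument. The following conditions are equivalent. (1) $E$ is $\nu$-flexibly BS-rigid. (2) For every sequence of functions $(f_\ell\colon\Gamma\to\mathrm{Sym}(n_\ell))_{\ell=1}^\infty$ with $n_\ell\to\infty$ such that $$d(f_\ell(\gamma_1\gamma_2),f_\ell(\gamma_1)f_\ell(\gamma_2))\to_{\ell\to\infty}0\qquad\forall\gamma_1,\gamma_2\in\Gamma,$$ if there is a sequence of homomorphisms $(g_\ell\colon\Gamma\to\mathrm{Sym}(n_\ell))_{\ell=1}^\infty$ such that $$d_{\mathrm{TV}}(N_{f_\ell,Q},N_{g_\ell,Q})\to_{\ell\to\infty}0\qquad\text{for every finite }Q\subset\Gamma,$$ then there are a sequence $(\varepsilon_\ell)_{\ell=1}^\infty$ of positive reals with $\varepsilon_\ell\to0$ and a sequence of homomorphisms $(h_\ell\colon\Gamma\to\mathrm{Sym}(N_\ell))_{\ell=1}^\infty$, $N_\ell\in\mathbb{N}$, with $n_\ell\le N_\ell\le n_\ell+\nu(\varepsilon_\ell,n_\ell)$ for all $\ell$, such that $$d(f_\ell(\gamma),h_\ell(\gamma))\to_{\ell\to\infty}0\qquad\forall\gamma\in\Gamma.$$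
   Context: $F_S$ is the free group on $S$; $[n]=\{1,\dots,n\}$; $\mathrm{Sym}(n)$ is the symmetric group on $[n]$. For $\sigma\in\mathrm{Sym}(n)$ and $\tau\in\mathrm{Sym}(N)$ with $N\ge n$, $d(\sigma,\tau)=d(\tau,\sigma)=\frac1n|\{x\in[n]\mid\sigma x\neq\tau x\}|$. For $\overline\sigma=(\sigma_1,\dots,\sigma_k)\in\mathrm{Sym}(n)^k$ and $w\in F_S$, $w(\overline\sigma)$ is the image of $w$ under the homomorphism $F_S\to\mathrm{Sym}(n)$ with $s_i\mapsto\sigma_i$. Put $\mathrm{Sol}_E(n)=\{\overline\sigma\in\mathrm{Sym}(n)^k\mid\forall w\in E,\ w(\overline\sigma)=\mathrm{id}\}$. For $\varepsilon>0$ let $\mathrm{Sol}_E^{<\varepsilon,\nu\text{-flex}}(n)$ be the set of $\overline\sigma\in\mathrm{Sym}(n)^k$ for which there exist $N\in\mathbb{N}$ with $n\le N\le n+\nu(\varepsilon,n)$ and $\overline\tau\in\mathrm{Sol}_E(N)$ with $\sum_{i=1}^kd(\sigma_i,\tau_i)<\varepsilon$; let $\mathrm{Sol}_E^{\ge\varepsilon,\nu\text{-flex}}(n)=\mathrm{Sym}(n)^k\setminus\mathrm{Sol}_E^{<\varepsilon,\nu\text{-flex}}(n)$. Total variation distance: $d_{\mathrm{TV}}(\theta_1,\theta_2)=\frac12\sum_{x\in\Omega}|\theta_1(x)-\theta_2(x)|$ for distributions on a finite set $\Omega$. For finite $P\subseteq F_S$ and $\overline\sigma\in\mathrm{Sym}(n)^k$,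 $N_{\overline\sigma,P}$ is the distribution on $2^P$ of $\{w\in P\mid w(\overline\sigma)x=x\}$ with $x$ uniform in $[n]$. For $f\colon\Gamma\to\mathrm{Sym}(n)$ and finite $Q\subset\Gamma$, $N_{f,Q}$ is the distribution on $2^Q$ of $\{\gamma\in Q\mid f(\gamma)x=x\}$ with $x$ uniform in $[n]$. A subset $E\subseteq F_S$ is $\nu$-flexibly BS-rigid if for every $\varepsilon>0$ there exist a finite set $P\subseteq F_S$ and $\delta>0$ such that $d_{\mathrm{TV}}(N_{\overline\sigma,P},N_{\overline\tau,P})\ge\delta$ for every $n\in\mathbb{N}$, $\overline\sigma\in\mathrm{Sol}_E^{\ge\varepsilon,\nu\text{-flex}}(n)$ and $\overline\tau\in\mathrm{Sol}_E(n)$. *)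

theory Defs
  imports
    "HOL-Algebra.Sym_Groups"
    "HOL-Probability.Probability_Mass_Function"
    "HOL-Library.Extended_Nat"
begin

section \<open>Free groups and presentations\<close>

text \<open>
  The letter \<open>(s, True)\<close> stands for the generator \<open>s\<close> and \<open>(s, False)\<close> for its inverse. Elements of
  the free group are the freely reduced words.
\<close>

type_synonym 's fword = "('s \<times> bool) list"

definition letter_inv :: "'s \<times> bool \<Rightarrow> 's \<times> bool" where
  "letter_inv x = (fst x, \<not> snd x)"

fun reduced_word :: "'s fword \<Rightarrow> bool" where
  "reduced_word (x # y # w) = (y \<noteq> letter_inv x \<and> reduced_word (y # w))"
| "reduced_word _ = True"

fun reduced_Cons :: "'s \<times> bool \<Rightarrow> 's fword \<Rightarrow> 's fword" where
  "reduced_Cons x [] = [x]"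
| "reduced_Cons x (y # w) = (if y = letter_inv x then w else x # y # w)"

definition free_group :: "'s set \<Rightarrow> 's fword monoid" where
  "free_group S =
     \<lparr>carrier = {w. reduced_word w \<and> set w \<subseteq> S \<times> UNIV},
      mult = (\<lambda>u v. foldr reduced_Cons u v),
      one = []\<rparr>"

text \<open>
  The image of \<open>w\<close> under the homomorphism from the free group to \<open>G\<close> that sends each generator \<open>s\<close>
  to \<open>\<sigma> s\<close>; see \<open>free_eval_hom\<close>, \<open>free_eval_gen\<close> and \<open>free_eval_unique\<close> below.
\<close>

fun free_eval :: "('g, 'b) monoid_scheme \<Rightarrow> ('s \<Rightarrow> 'g) \<Rightarrow> 's fword \<Rightarrow> 'g" where
  "free_eval G \<sigma> [] = \<one>\<^bsub>G\<^esub>"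
| "free_eval G \<sigma> (x # w) =
     (if snd x then \<sigma> (fst x) else inv\<^bsub>G\<^esub> \<sigma> (fst x)) \<otimes>\<^bsub>G\<^esub> free_eval G \<sigma> w"

definition normal_closure :: "('g, 'b) monoid_scheme \<Rightarrow> 'g set \<Rightarrow> 'g set" where
  "normal_closure G E = \<Inter> {N. N \<lhd> G \<and> E \<subseteq> N}"

definition presented_group :: "'s set \<Rightarrow> 's fword set \<Rightarrow> 's fword set monoid" where
  "presented_group S E = free_group S Mod normal_closure (free_group S) E"


subsection \<open>The free group is a group with the expected universal property\<close>

lemma letter_inv_letter_inv [simp]: "letter_inv (letter_inv x) = x"
  by (simp add: letter_inv_def)

lemma letter_inv_neq [simp]: "letter_inv x \<noteq> x" "x \<noteq> letter_inv x"
  by (metis letter_inv_def snd_conv)+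

lemma letter_inv_in [simp]: "letter_inv x \<in> S \<times> UNIV \<longleftrightarrow> x \<in> S \<times> UNIV"
  by (cases x) (auto simp: letter_inv_def)

lemma reduced_ConsD: "reduced_word (x # w) \<Longrightarrow> reduced_word w"
  by (cases w) auto

lemma reduced_reduced_Cons: "reduced_word w \<Longrightarrow> reduced_word (reduced_Cons x w)"
  by (cases w) (auto dest: reduced_ConsD)

lemma reduced_Cons_reduced: "reduced_word (x # w) \<Longrightarrow> reduced_Cons x w = x # w"
  by (cases w) auto

lemma reduced_Cons_inv: "reduced_word w \<Longrightarrow> reduced_Cons x (reduced_Cons (letter_inv x) w) = w"
  by (cases w) (auto simp: reduced_Cons_reduced)

lemma set_reduced_Cons: "set (reduced_Cons x w) \<subseteq> insert x (set w)"
  by (cases w) auto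

lemma reduced_foldr: "reduced_word v \<Longrightarrow> reduced_word (foldr reduced_Cons u v)"
  by (induction u) (auto intro: reduced_reduced_Cons)

lemma set_foldr: "set (foldr reduced_Cons u v) \<subseteq> set u \<union> set v"
  by (induction u) (use set_reduced_Cons in fastforce)+

lemma foldr_reduced_Cons:
  assumes "reduced_word w"
  shows "foldr reduced_Cons (reduced_Cons x v) w = reduced_Cons x (foldr reduced_Cons v w)"
  using reduced_Cons_inv[of _ x] reduced_foldr[OF assms] by (cases v) auto

lemma foldr_reduced_assoc:
  assumes "reduced_word w"
  shows "foldr reduced_Cons (foldr reduced_Cons u v) w
         = foldr reduced_Cons u (foldr reduced_Cons v w)"
  by (induction u) (simp_all add: foldr_reduced_Cons[OF assms])

lemma foldr_reduced_Nil: "reduced_word w \<Longrightarrow> foldr reduced_Cons w [] = w"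
proof (induction w)
  case (Cons x w)
  then show ?case using reduced_Cons_reduced[of x w] reduced_ConsD[of x w] by simp
qed simp

definition word_inv :: "'s fword \<Rightarrow> 's fword" where
  "word_inv w = rev (map letter_inv w)"

lemma foldr_word_inv: "foldr reduced_Cons (word_inv w) w = []"
proof (induction w)
  case (Cons x w)
  have "reduced_Cons (letter_inv x) (x # w) = w" by simp
  with Cons show ?case by (simp add: word_inv_def)
qed (simp add: word_inv_def)

lemma free_group_group: "group (free_group S)"
proof (rule groupI)
  fix u v assume "u \<in> carrier (free_group S)" "v \<in> carrier (free_group S)"
  then show "u \<otimes>\<^bsub>free_group S\<^esub> v \<in> carrier (free_group S)"
    using set_foldr[of u v] by (auto simp: free_group_def reduced_foldr)
next
  fix w assume w: "w \<in> carrier (free_group S)"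
  let ?v = "foldr reduced_Cons (word_inv w) []"
  have "set (word_inv w) \<subseteq> S \<times> UNIV"
    using w by (auto simp: free_group_def word_inv_def letter_inv_def)
  then have "?v \<in> carrier (free_group S)"
    using set_foldr[of "word_inv w" "[]"] by (auto simp: free_group_def reduced_foldr)
  moreover have "?v \<otimes>\<^bsub>free_group S\<^esub> w = \<one>\<^bsub>free_group S\<^esub>"
    using w by (simp add: free_group_def foldr_reduced_assoc foldr_word_inv)
  ultimately show "\<exists>v\<in>carrier (free_group S). v \<otimes>\<^bsub>free_group S\<^esub> w = \<one>\<^bsub>free_group S\<^esub>"
    by blast
qed (auto simp: free_group_def foldr_reduced_assoc)

context group
begin

lemma free_eval_closed:
  "\<sigma> \<in> S \<rightarrow> carrier G \<Longrightarrow> set w \<subseteq> S \<times> UNIV \<Longrightarrow> free_eval G \<sigma> w \<in> carrier G"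
  by (induction w) (auto simp: Pi_iff)

lemma free_eval_reduced_Cons:
  assumes "\<sigma> \<in> S \<rightarrow> carrier G" "x \<in> S \<times> UNIV" "set w \<subseteq> S \<times> UNIV"
  shows "free_eval G \<sigma> (reduced_Cons x w) = free_eval G \<sigma> (x # w)"
proof (cases w)
  case (Cons y v)
  have "\<sigma> (fst x) \<in> carrier G" "free_eval G \<sigma> v \<in> carrier G"
    using assms Cons by (auto intro: free_eval_closed)
  then show ?thesis
    using Cons by (auto simp: letter_inv_def m_assoc[symmetric])
qed simp

lemma free_eval_foldr:
  assumes "\<sigma> \<in> S \<rightarrow> carrier G" "set u \<subseteq> S \<times> UNIV" "set v \<subseteq> S \<times> UNIV"
  shows "free_eval G \<sigma> (foldr reduced_Cons u v) = free_eval G \<sigma> u \<otimes> free_eval G \<sigma> v"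
  using assms(2)
proof (induction u)
  case Nil
  then show ?case using free_eval_closed[OF assms(1,3)] by simp
next
  case (Cons x u)
  have S: "set (foldr reduced_Cons u v) \<subseteq> S \<times> UNIV" "x \<in> S \<times> UNIV" "set u \<subseteq> S \<times> UNIV"
    using set_foldr[of u v] Cons.prems assms(3) by auto
  have "\<sigma> (fst x) \<in> carrier G" using assms(1) S(2) by auto
  then show ?case
    using Cons.IH[OF S(3)] free_eval_reduced_Cons[OF assms(1) S(2,1)]
      free_eval_closed[OF assms(1) S(3)] free_eval_closed[OF assms(1,3)]
    by (simp add: m_assoc)
qed

lemma free_eval_hom:
  assumes "\<sigma> \<in> S \<rightarrow> carrier G"
  shows "free_eval G \<sigma> \<in> hom (free_group S) G"
  by (rule homI)
    (auto simp: free_group_def intro!: free_eval_closed[OF assms] free_eval_foldr[OF assms])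

lemma free_eval_gen:
  assumes "\<sigma> \<in> S \<rightarrow> carrier G" "s \<in> S"
  shows "free_eval G \<sigma> [(s, True)] = \<sigma> s"
  using assms by (auto simp: Pi_iff)

lemma free_eval_unique:
  assumes h: "h \<in> hom (free_group S) G" and gen: "\<And>s. s \<in> S \<Longrightarrow> h [(s, True)] = \<sigma> s"
    and w: "w \<in> carrier (free_group S)"
  shows "h w = free_eval G \<sigma> w"
proof -
  interpret F: group "free_group S" by (rule free_group_group)
  interpret H: group_hom "free_group S" G h
    using h by (simp add: group_hom_def group_hom_axioms_def F.is_group is_group)
  have letter: "h [x] = (if snd x then \<sigma> (fst x) else inv \<sigma> (fst x))" if "x \<in> S \<times> UNIV" for x
  proof (cases "snd x")
    case True
    then show ?thesis using gen[of "fst x"] that by (cases x) auto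
  next
    case False
    have m: "[x] \<in> carrier (free_group S)" "[(fst x, True)] \<in> carrier (free_group S)"
      using that by (auto simp: free_group_def)
    have "[x] \<otimes>\<^bsub>free_group S\<^esub> [(fst x, True)] = \<one>\<^bsub>free_group S\<^esub>"
      using False by (simp add: free_group_def letter_inv_def)
    then have "[x] = inv\<^bsub>free_group S\<^esub> [(fst x, True)]"
      using m F.inv_equality by metis
    then have "h [x] = inv (h [(fst x, True)])"
      using m(2) by simp
    also have "h [(fst x, True)] = \<sigma> (fst x)"
      using gen that by auto
    finally show ?thesis using False by simp
  qed
  show ?thesis using w
  proof (induction w)
    case Nil
    then show ?case using H.hom_one by (simp add: free_group_def)
  next
    case (Cons x w)
    then have m: "[x] \<in> carrier (free_group S)" "w \<in> carrier (free_group S)" "x \<in> S \<times> UNIV"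
      by (auto simp: free_group_def dest: reduced_ConsD)
    have "x # w = [x] \<otimes>\<^bsub>free_group S\<^esub> w"
      using Cons.prems by (simp add: free_group_def reduced_Cons_reduced)
    then have "h (x # w) = h [x] \<otimes> h w"
      using m H.hom_mult by metis
    then show ?case using Cons.IH[OF m(2)] letter[OF m(3)] by simp
  qed
qed

end


section \<open>Permutations, stability and rigidity\<close>

text \<open>
  The normalised distance between a permutation of \<open>{1..n}\<close> and a permutation of \<open>{1..N}\<close> with
  \<open>N \<ge> n\<close>. The smaller degree \<open>n\<close> is an argument because an element of \<^term>\<open>sym_group n\<close> is a
  function on all of \<^typ>\<open>nat\<close> and does not determine its degree.
\<close>

definition perm_dist :: "nat \<Rightarrow> (nat \<Rightarrow> nat) \<Rightarrow> (nat \<Rightarrow> nat) \<Rightarrow> real" where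
  "perm_dist n \<sigma> \<tau> = real (card {x \<in> {1..n}. \<sigma> x \<noteq> \<tau> x}) / real n"

definition perm_tuples :: "'s set \<Rightarrow> nat \<Rightarrow> ('s \<Rightarrow> nat \<Rightarrow> nat) set" where
  "perm_tuples S n = (S \<rightarrow>\<^sub>E carrier (sym_group n))"

definition Sol :: "'s set \<Rightarrow> 's fword set \<Rightarrow> nat \<Rightarrow> ('s \<Rightarrow> nat \<Rightarrow> nat) set" where
  "Sol S E n = {\<sigma> \<in> perm_tuples S n. \<forall>w\<in>E. free_eval (sym_group n) \<sigma> w = \<one>\<^bsub>sym_group n\<^esub>}"

definition Sol_near ::
  "(real \<Rightarrow> nat \<Rightarrow> enat) \<Rightarrow> 's set \<Rightarrow> 's fword set \<Rightarrow> real \<Rightarrow> nat \<Rightarrow> ('s \<Rightarrow> nat \<Rightarrow> nat) set" where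
  "Sol_near \<nu> S E \<epsilon> n =
     {\<sigma> \<in> perm_tuples S n.
        \<exists>N \<tau>. n \<le> N \<and> enat N \<le> enat n + \<nu> \<epsilon> n \<and> \<tau> \<in> Sol S E N \<and>
              (\<Sum>s\<in>S. perm_dist n (\<sigma> s) (\<tau> s)) < \<epsilon>}"

definition Sol_far ::
  "(real \<Rightarrow> nat \<Rightarrow> enat) \<Rightarrow> 's set \<Rightarrow> 's fword set \<Rightarrow> real \<Rightarrow> nat \<Rightarrow> ('s \<Rightarrow> nat \<Rightarrow> nat) set" where
  "Sol_far \<nu> S E \<epsilon> n = perm_tuples S n - Sol_near \<nu> S E \<epsilon> n"

definition tv_dist :: "'a set \<Rightarrow> 'a pmf \<Rightarrow> 'a pmf \<Rightarrow> real" where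
  "tv_dist \<Omega> p q = (\<Sum>x\<in>\<Omega>. \<bar>pmf p x - pmf q x\<bar>) / 2"

text \<open>
  The distribution of \<open>{q \<in> Q. a q x = x}\<close> for \<open>x\<close> uniform in \<open>{1..n}\<close> (meaningful for \<open>n \<ge> 1\<close>).
  It is used both with \<open>a = free_eval (sym_group n) \<sigma>\<close>, which gives the distribution attached to a
  tuple \<open>\<sigma>\<close> and a set of words, and with a function \<open>a\<close> from a presented group to permutations.
\<close>

definition stab_distr :: "nat \<Rightarrow> ('q \<Rightarrow> nat \<Rightarrow> nat) \<Rightarrow> 'q set \<Rightarrow> 'q set pmf" where
  "stab_distr n a Q = map_pmf (\<lambda>x. {q \<in> Q. a q x = x}) (pmf_of_set {1..n})"

definition flexibly_BS_rigid ::
  "(real \<Rightarrow> nat \<Rightarrow> enat) \<Rightarrow> 's set \<Rightarrow> 's fword set \<Rightarrow> bool" where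
  "flexibly_BS_rigid \<nu> S E \<longleftrightarrow>
     (\<forall>\<epsilon>>0. \<exists>P \<delta>. finite P \<and> P \<subseteq> carrier (free_group S) \<and> \<delta> > 0 \<and>
        (\<forall>n\<ge>1. \<forall>\<sigma>\<in>Sol_far \<nu> S E \<epsilon> n. \<forall>\<tau>\<in>Sol S E n.
           tv_dist (Pow P) (stab_distr n (free_eval (sym_group n) \<sigma>) P)
                           (stab_distr n (free_eval (sym_group n) \<tau>) P) \<ge> \<delta>))"

end

theory Submission
  imports Defs
begin

text \<open>
  An almost homomorphism \<open>f\<^sub>l\<close> of \<open>\<Gamma>\<close> and a tuple \<open>\<sigma>\<^sub>l\<close> of permutations determine each other up to
  \<open>o(1)\<close>: restrict \<open>f\<^sub>l\<close> to the generators, or evaluate \<open>\<sigma>\<^sub>l\<close> at a chosen representative of each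
  element of \<open>\<Gamma>\<close>. The total variation distance of stabiliser distributions can only decrease when
  words are mapped to \<open>\<Gamma>\<close> or elements of \<open>\<Gamma>\<close> to representatives, and it changes by at most the sum
  of the distances of the permutations involved. Rigidity thus puts \<open>\<sigma>\<^sub>l\<close> eventually into
  \<open>Sol_near \<epsilon>\<close> for each \<open>\<epsilon>\<close>, and a diagonal choice gives \<open>\<epsilon>\<^sub>l\<close>. Conversely, if rigidity fails at
  \<open>\<epsilon>\<close>, the counterexamples for larger and larger balls of words and \<open>\<delta> = 1 / (l + 1)\<close> form almost
  homomorphisms: a word trivial in \<open>\<Gamma>\<close> fixes every point under \<open>\<tau>\<^sub>l\<close>, hence almost every point
  under \<open>\<sigma>\<^sub>l\<close>. Their degrees can be taken to tend to infinity, since the finitely many non-solutions of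
  degree less than \<open>M\<close> are recognised by finitely many relators, each moving a proportion of at
  least \<open>1 / M\<close> of the points.
\<close>

section \<open>The distance between permutations\<close>

lemma perm_dist_nonneg: "0 \<le> perm_dist n a b"
  by (simp add: perm_dist_def)

lemma perm_dist_commute: "perm_dist n a b = perm_dist n b a"
proof -
  have "{x \<in> {1..n}. a x \<noteq> b x} = {x \<in> {1..n}. b x \<noteq> a x}"
    by auto
  then show ?thesis
    by (simp add: perm_dist_def)
qed

lemma perm_dist_mono:
  assumes "\<And>x. x \<in> {1..n} \<Longrightarrow> a x \<noteq> b x \<Longrightarrow> c x \<noteq> d x"
  shows "perm_dist n a b \<le> perm_dist n c d"
  unfolding perm_dist_def
  by (intro divide_right_mono of_nat_mono card_mono) (use assms in auto)

lemma perm_dist_le_add: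
  assumes "\<And>x. x \<in> {1..n} \<Longrightarrow> a x \<noteq> b x \<Longrightarrow> c x \<noteq> d x \<or> c' x \<noteq> d' x"
  shows "perm_dist n a b \<le> perm_dist n c d + perm_dist n c' d'"
proof -
  have "card {x \<in> {1..n}. a x \<noteq> b x}
      \<le> card ({x \<in> {1..n}. c x \<noteq> d x} \<union> {x \<in> {1..n}. c' x \<noteq> d' x})"
    by (rule card_mono) (use assms in auto)
  also have "\<dots> \<le> card {x \<in> {1..n}. c x \<noteq> d x} + card {x \<in> {1..n}. c' x \<noteq> d' x}"
    by (rule card_Un_le)
  finally show ?thesis
    by (simp add: perm_dist_def divide_right_mono flip: add_divide_distrib of_nat_add)
qed

lemma perm_dist_triangle: "perm_dist n a c \<le> perm_dist n a b + perm_dist n b c"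
  by (rule perm_dist_le_add) auto

text \<open>\<open>p\<close> maps the points where the composites disagree bijectively onto those
  where \<open>a\<close> and \<open>b\<close> disagree. As \<open>a\<close> and \<open>b\<close> are
  arbitrary functions, one of them may be a permutation of larger degree.\<close>

lemma perm_dist_comp_right:
  assumes "p permutes {1..n}"
  shows "perm_dist n (a \<circ> p) (b \<circ> p) = perm_dist n a b"
proof -
  have "p ` {x \<in> {1..n}. (a \<circ> p) x \<noteq> (b \<circ> p) x} = {x \<in> {1..n}. a x \<noteq> b x}"
  proof (intro equalityI subsetI)
    fix y assume y: "y \<in> {x \<in> {1..n}. a x \<noteq> b x}"
    then obtain x where "y = p x" "x \<in> {1..n}"
      using permutes_image[OF assms] by blast
    then show "y \<in> p ` {x \<in> {1..n}. (a \<circ> p) x \<noteq> (b \<circ> p) x}"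
      using y by auto
  qed (use permutes_in_image[OF assms] in auto)
  moreover have "card (p ` {x \<in> {1..n}. (a \<circ> p) x \<noteq> (b \<circ> p) x})
      = card {x \<in> {1..n}. (a \<circ> p) x \<noteq> (b \<circ> p) x}"
    by (rule card_image) (rule inj_on_subset[OF permutes_inj[OF assms] subset_UNIV])
  ultimately show ?thesis
    by (simp add: perm_dist_def)
qed

lemma perm_dist_comp_left: "inj p \<Longrightarrow> perm_dist n (p \<circ> a) (p \<circ> b) = perm_dist n a b"
  by (simp add: perm_dist_def inj_eq)

text \<open>Where \<open>p\<close> and \<open>q\<close> agree at \<open>x\<close>, a disagreement of
  the composites is one of \<open>a\<close> and \<open>b\<close> at \<open>p x\<close>. Only
  \<open>p\<close> has to preserve \<open>{1..n}\<close>, so the right-hand factors \<open>b\<close>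
  and \<open>q\<close> may live in a larger degree.\<close>

lemma perm_dist_comp:
  assumes "p permutes {1..n}"
  shows "perm_dist n (a \<circ> p) (b \<circ> q) \<le> perm_dist n a b + perm_dist n p q"
proof -
  have "perm_dist n (a \<circ> p) (b \<circ> q) \<le> perm_dist n (a \<circ> p) (b \<circ> p) + perm_dist n p q"
    by (rule perm_dist_le_add) auto
  then show ?thesis
    by (simp add: perm_dist_comp_right[OF assms])
qed

text \<open>Composing with \<open>p\<close> on the right turns \<open>inv' p\<close> into the
  identity, and \<open>p x = q x\<close> gives \<open>inv' q (p x) = x\<close> by injectivity of
  \<open>q\<close>.\<close>

lemma perm_dist_inv:
  assumes "p permutes {1..n}" "inj q"
  shows "perm_dist n (inv' p) (inv' q) \<le> perm_dist n p q"
proof -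
  have "perm_dist n (inv' p) (inv' q) = perm_dist n (inv' p \<circ> p) (inv' q \<circ> p)"
    by (simp only: perm_dist_comp_right[OF assms(1)])
  also have "\<dots> \<le> perm_dist n p q"
    using assms by (intro perm_dist_mono) (auto simp: permutes_inverses dest: inv_f_f)
  finally show ?thesis .
qed

text \<open>A permutation other than the identity moves at least one point. This gap later excludes
  small degrees.\<close>

lemma perm_dist_id_ge:
  assumes "p permutes {1..n}" "p \<noteq> id"
  shows "1 / real n \<le> perm_dist n p id"
proof -
  obtain x where "p x \<noteq> x" "x \<in> {1..n}"
    using assms by (metis eq_id_iff permutes_not_in)
  then have "{x} \<subseteq> {x \<in> {1..n}. p x \<noteq> id x}"
    by auto
  then have "1 \<le> card {x \<in> {1..n}. p x \<noteq> id x}"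
    using card_mono[of "{x \<in> {1..n}. p x \<noteq> id x}" "{x}"] by simp
  then show ?thesis
    by (simp add: perm_dist_def divide_right_mono)
qed

section \<open>Evaluation of words at tuples of permutations\<close>

lemma free_eval_permutes:
  assumes "\<sigma> \<in> S \<rightarrow> carrier (sym_group n)" "set w \<subseteq> S \<times> UNIV"
  shows "free_eval (sym_group n) \<sigma> w permutes {1..n}"
  using group.free_eval_closed[OF sym_group_is_group assms] by (simp add: sym_group_carrier)

text \<open>\<open>perm_dist_comp\<close> splits off one letter at a time, and each letter costs at
  most the total distance over all generators. The two degrees may differ, as flexible solutions
  require.\<close>

lemma perm_dist_free_eval:
  assumes \<sigma>: "\<sigma> \<in> S \<rightarrow> carrier (sym_group n)" and \<tau>: "\<tau> \<in> S \<rightarrow> carrier (sym_group N)"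
    and S: "finite S" and w: "set w \<subseteq> S \<times> UNIV"
  shows "perm_dist n (free_eval (sym_group n) \<sigma> w) (free_eval (sym_group N) \<tau> w)
    \<le> real (length w) * (\<Sum>s\<in>S. perm_dist n (\<sigma> s) (\<tau> s))"
  using w
proof (induction w)
  case Nil
  then show ?case by (simp add: perm_dist_def sym_group_one)
next
  case (Cons x w)
  \<comment> \<open>\<open>\<phi>\<close> and \<open>\<psi>\<close> are the values of the first
    letter on the two sides; for an inverse letter \<open>perm_dist_inv\<close> reduces their
    distance to that of the generators.\<close>
  define \<phi> where "\<phi> = (if snd x then \<sigma> (fst x) else inv\<^bsub>sym_group n\<^esub> \<sigma> (fst x))"
  define \<psi> where "\<psi> = (if snd x then \<tau> (fst x) else inv\<^bsub>sym_group N\<^esub> \<tau> (fst x))"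
  have x: "fst x \<in> S" and w: "set w \<subseteq> S \<times> UNIV"
    using Cons.prems by auto
  have p: "\<sigma> (fst x) permutes {1..n}" "\<tau> (fst x) permutes {1..N}"
    using \<sigma> \<tau> x by (auto simp: Pi_iff sym_group_carrier)
  have "perm_dist n \<phi> \<psi> \<le> perm_dist n (\<sigma> (fst x)) (\<tau> (fst x))"
    using p perm_dist_inv[OF p(1) permutes_inj[OF p(2)]]
    by (simp add: \<phi>_def \<psi>_def sym_group_carrier)
  also have "\<dots> \<le> (\<Sum>s\<in>S. perm_dist n (\<sigma> s) (\<tau> s))"
    by (rule member_le_sum) (use x S perm_dist_nonneg in auto)
  finally have "perm_dist n \<phi> \<psi> \<le> (\<Sum>s\<in>S. perm_dist n (\<sigma> s) (\<tau> s))" .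
  then have "perm_dist n (\<phi> \<circ> free_eval (sym_group n) \<sigma> w) (\<psi> \<circ> free_eval (sym_group N) \<tau> w)
      \<le> (1 + real (length w)) * (\<Sum>s\<in>S. perm_dist n (\<sigma> s) (\<tau> s))"
    unfolding distrib_right using Cons.IH[OF w]
      perm_dist_comp[OF free_eval_permutes[OF \<sigma> w], of \<phi> \<psi> "free_eval (sym_group N) \<tau> w"]
    by linarith
  then show ?case
    unfolding free_eval.simps sym_group_mult \<phi>_def \<psi>_def by (simp only: length_Cons of_nat_Suc)
qed


section \<open>Stabiliser distributions\<close>

lemma tv_dist_nonneg: "0 \<le> tv_dist \<Omega> p q"
  by (simp add: tv_dist_def sum_nonneg)

lemma tv_dist_triangle: "tv_dist \<Omega> p r \<le> tv_dist \<Omega> p q + tv_dist \<Omega> q r"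
  unfolding tv_dist_def add_divide_distrib[symmetric] sum.distrib[symmetric]
  by (intro divide_right_mono sum_mono) auto

text \<open>The mass of a point of the image is the mass of its fibre. The triangle inequality
  inside each fibre, followed by summation over disjoint fibres, shows that a pushforward does not
  increase the distance.\<close>

lemma tv_dist_map_pmf_le:
  assumes "finite \<Omega>" "finite \<Omega>'" "set_pmf p \<subseteq> \<Omega>" "set_pmf q \<subseteq> \<Omega>"
  shows "tv_dist \<Omega>' (map_pmf F p) (map_pmf F q) \<le> tv_dist \<Omega> p q"
proof -
  have pmf: "pmf (map_pmf F r) y = (\<Sum>x | x \<in> \<Omega> \<and> F x = y. pmf r x)"
    if "set_pmf r \<subseteq> \<Omega>" for r y
  proof -
    \<comment> \<open>The full preimage may contain points outside \<open>\<Omega>\<close>, but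
      these have probability zero.\<close>
    have "measure r (F -` {y}) = measure r {x \<in> \<Omega>. F x = y}"
      by (rule measure_prob_cong_0) (use that in \<open>auto simp: set_pmf_eq\<close>)
    then show ?thesis
      using assms(1) by (simp add: pmf_map measure_measure_pmf_finite)
  qed
  have "(\<Sum>y\<in>\<Omega>'. \<bar>pmf (map_pmf F p) y - pmf (map_pmf F q) y\<bar>)
      = (\<Sum>y\<in>\<Omega>'. \<bar>\<Sum>x | x \<in> \<Omega> \<and> F x = y. pmf p x - pmf q x\<bar>)"
    by (simp add: pmf assms sum_subtractf)
  also have "\<dots> \<le> (\<Sum>y\<in>\<Omega>'. \<Sum>x | x \<in> \<Omega> \<and> F x = y. \<bar>pmf p x - pmf q x\<bar>)"
    by (intro sum_mono sum_abs)
  also have "\<dots> = (\<Sum>x | x \<in> \<Omega> \<and> F x \<in> \<Omega>'. \<bar>pmf p x - pmf q x\<bar>)"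
  proof -
    \<comment> \<open>The fibres over \<open>\<Omega>'\<close> partition the points of
      \<open>\<Omega>\<close> that \<open>F\<close> sends into \<open>\<Omega>'\<close>.\<close>
    have "(\<Sum>y\<in>\<Omega>'. \<Sum>x | x \<in> {x \<in> \<Omega>. F x \<in> \<Omega>'} \<and> F x = y. \<bar>pmf p x - pmf q x\<bar>)
        = (\<Sum>x | x \<in> \<Omega> \<and> F x \<in> \<Omega>'. \<bar>pmf p x - pmf q x\<bar>)"
      by (rule sum.group) (use assms in auto)
    moreover have "{x \<in> {x \<in> \<Omega>. F x \<in> \<Omega>'}. F x = y} = {x \<in> \<Omega>. F x = y}" if "y \<in> \<Omega>'" for y
      using that by auto
    ultimately show ?thesis
      by (simp cong: sum.cong)
  qed
  also have "\<dots> \<le> (\<Sum>x\<in>\<Omega>. \<bar>pmf p x - pmf q x\<bar>)"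
    by (rule sum_mono2) (use assms in auto)
  finally show ?thesis
    by (simp add: tv_dist_def divide_right_mono)
qed

lemma set_stab_distr: "set_pmf (stab_distr n a Q) \<subseteq> Pow Q"
  by (auto simp: stab_distr_def)

lemma pmf_stab_distr:
  assumes "1 \<le> n"
  shows "pmf (stab_distr n a Q) A = card {x \<in> {1..n}. {q \<in> Q. a q x = x} = A} / n"
proof -
  have "{1..n} \<inter> (\<lambda>x. {q \<in> Q. a q x = x}) -` {A} = {x \<in> {1..n}. {q \<in> Q. a q x = x} = A}"
    by auto
  with assms show ?thesis
    by (simp add: stab_distr_def pmf_map measure_pmf_of_set)
qed

lemma stab_distr_cong:
  assumes "1 \<le> n" "\<And>q x. q \<in> Q \<Longrightarrow> x \<in> {1..n} \<Longrightarrow> a q x = b q x"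
  shows "stab_distr n a Q = stab_distr n b Q"
  unfolding stab_distr_def by (rule map_pmf_cong) (use assms in auto)

text \<open>Whether \<open>w\<close> fixes \<open>x\<close> under \<open>a \<circ> r\<close> can be
  read off from the pattern of \<open>x\<close> over \<open>Q\<close>, because \<open>r w\<close>
  lies in \<open>Q\<close>. The map \<open>r\<close> will be \<open>proj\<close>, \<open>rep\<close>
  or the identity.\<close>

lemma stab_distr_comp:
  assumes "1 \<le> n" "r ` P \<subseteq> Q"
  shows "stab_distr n (a \<circ> r) P = map_pmf (\<lambda>A. {w \<in> P. r w \<in> A}) (stab_distr n a Q)"
  unfolding stab_distr_def map_pmf_comp
  by (rule map_pmf_cong) (use assms in auto)

lemma tv_dist_stab_distr_comp_le:
  assumes "1 \<le> n" "r ` P \<subseteq> Q" "finite P" "finite Q"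
  shows "tv_dist (Pow P) (stab_distr n (a \<circ> r) P) (stab_distr n (b \<circ> r) P)
    \<le> tv_dist (Pow Q) (stab_distr n a Q) (stab_distr n b Q)"
  unfolding stab_distr_comp[OF assms(1,2)]
  by (rule tv_dist_map_pmf_le) (use assms in \<open>simp_all add: set_stab_distr\<close>)

lemma tv_dist_stab_distr_mono:
  assumes "1 \<le> n" "P \<subseteq> Q" "finite Q"
  shows "tv_dist (Pow P) (stab_distr n a P) (stab_distr n b P)
    \<le> tv_dist (Pow Q) (stab_distr n a Q) (stab_distr n b Q)"
  using tv_dist_stab_distr_comp_le[of n id P Q a b] assms finite_subset by auto

text \<open>A coupling argument: with the same \<open>x\<close> sampled on both sides, the two
  patterns differ only if some \<open>q\<close> in \<open>Q\<close> acts differently at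
  \<open>x\<close>.\<close>

lemma tv_dist_stab_distr_le_perm_dist:
  assumes n: "1 \<le> n" and Q: "finite Q"
  shows "tv_dist (Pow Q) (stab_distr n a Q) (stab_distr n b Q) \<le> (\<Sum>q\<in>Q. perm_dist n (a q) (b q))"
proof -
  define X where "X x = {q \<in> Q. a q x = x}" for x
  define Y where "Y x = {q \<in> Q. b q x = x}" for x
  \<comment> \<open>The points whose two patterns differ; every other point contributes equally to
    both counts.\<close>
  define D where "D = {x \<in> {1..n}. X x \<noteq> Y x}"
  have D: "finite D"
    by (simp add: D_def)
  \<comment> \<open>Sorting the points of \<open>D\<close> by pattern counts each of them
    once.\<close>
  have part: "(\<Sum>A\<in>Pow Q. card {x \<in> D. Z x = A}) = card D" if "\<And>x. Z x \<subseteq> Q" for Z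
  proof -
    have "(\<Sum>A\<in>Pow Q. \<Sum>x | x \<in> D \<and> Z x = A. 1 :: nat) = (\<Sum>x\<in>D. 1)"
      by (rule sum.group) (use D Q that in auto)
    then show ?thesis by simp
  qed
  have diff: "\<bar>real (card {x \<in> {1..n}. X x = A}) - real (card {x \<in> {1..n}. Y x = A})\<bar>
      \<le> real (card {x \<in> D. X x = A}) + real (card {x \<in> D. Y x = A})" for A
  proof -
    have "card {x \<in> {1..n}. X x = A} \<le> card ({x \<in> {1..n}. Y x = A} \<union> {x \<in> D. X x = A})"
      by (rule card_mono) (auto simp: D_def)
    also have "\<dots> \<le> card {x \<in> {1..n}. Y x = A} + card {x \<in> D. X x = A}"
      by (rule card_Un_le)
    finally have 1: "card {x \<in> {1..n}. X x = A} \<le> card {x \<in> {1..n}. Y x = A} + card {x \<in> D. X x = A}" .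
    have "card {x \<in> {1..n}. Y x = A} \<le> card ({x \<in> {1..n}. X x = A} \<union> {x \<in> D. Y x = A})"
      by (rule card_mono) (auto simp: D_def)
    also have "\<dots> \<le> card {x \<in> {1..n}. X x = A} + card {x \<in> D. Y x = A}"
      by (rule card_Un_le)
    finally show ?thesis
      using 1 by linarith
  qed
  have "(\<Sum>A\<in>Pow Q. \<bar>pmf (stab_distr n a Q) A - pmf (stab_distr n b Q) A\<bar>)
      = (\<Sum>A\<in>Pow Q. \<bar>real (card {x \<in> {1..n}. X x = A}) - real (card {x \<in> {1..n}. Y x = A})\<bar> / n)"
    by (simp add: pmf_stab_distr[OF n] X_def Y_def flip: diff_divide_distrib)
  also have "\<dots> \<le> (\<Sum>A\<in>Pow Q. (real (card {x \<in> D. X x = A}) + real (card {x \<in> D. Y x = A})) / n)"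
    by (intro sum_mono divide_right_mono diff) auto
  also have "\<dots> = (real (\<Sum>A\<in>Pow Q. card {x \<in> D. X x = A}) + real (\<Sum>A\<in>Pow Q. card {x \<in> D. Y x = A})) / n"
    by (simp only: sum.distrib of_nat_sum flip: sum_divide_distrib)
  \<comment> \<open>Each point of \<open>D\<close> is counted once for \<open>X\<close> and once for
    \<open>Y\<close>; the factor 2 cancels the half in \<open>tv_dist\<close>.\<close>
  also have "\<dots> = 2 * (card D / n)"
    by (simp add: part X_def Y_def)
  finally have tv: "tv_dist (Pow Q) (stab_distr n a Q) (stab_distr n b Q) \<le> card D / n"
    by (simp add: tv_dist_def mult.commute)
  have "D \<subseteq> (\<Union>q\<in>Q. {x \<in> {1..n}. a q x \<noteq> b q x})"
    by (auto simp: D_def X_def Y_def)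
  then have "card D \<le> card (\<Union>q\<in>Q. {x \<in> {1..n}. a q x \<noteq> b q x})"
    using Q by (intro card_mono) auto
  also have "\<dots> \<le> (\<Sum>q\<in>Q. card {x \<in> {1..n}. a q x \<noteq> b q x})"
    by (rule card_UN_le[OF Q])
  finally have "card D \<le> (\<Sum>q\<in>Q. card {x \<in> {1..n}. a q x \<noteq> b q x})"
    by simp
  then have "card D / n \<le> (\<Sum>q\<in>Q. card {x \<in> {1..n}. a q x \<noteq> b q x}) / n"
    by (intro divide_right_mono of_nat_mono) auto
  with tv have "tv_dist (Pow Q) (stab_distr n a Q) (stab_distr n b Q)
      \<le> (\<Sum>q\<in>Q. card {x \<in> {1..n}. a q x \<noteq> b q x}) / n" by simp
  also have "\<dots> = (\<Sum>q\<in>Q. perm_dist n (a q) (b q))"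
    by (simp add: perm_dist_def sum_divide_distrib)
  finally show ?thesis by simp
qed

text \<open>Patterns omitting \<open>q\<close> have probability zero under \<open>b\<close>, while
  under \<open>a\<close> their total probability is the proportion of points moved by
  \<open>a q\<close>. The factor 2 undoes the half in \<open>tv_dist\<close>.\<close>

lemma perm_dist_id_le_tv_dist:
  assumes n: "1 \<le> n" and Q: "finite Q" "q \<in> Q" and b: "b q = id"
  shows "perm_dist n (a q) id \<le> 2 * tv_dist (Pow Q) (stab_distr n a Q) (stab_distr n b Q)"
proof -
  let ?Q = "{A \<in> Pow Q. q \<notin> A}"
  have b0: "pmf (stab_distr n b Q) A = 0" if "q \<notin> A" for A
  proof -
    have "{x \<in> {1..n}. {q \<in> Q. b q x = x} = A} = {}"
      using that b Q by auto
    then show ?thesis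
      by (simp add: pmf_stab_distr[OF n])
  qed
  \<comment> \<open>The points moved by \<open>a q\<close> are sorted by their pattern, which is
    always one that omits \<open>q\<close>.\<close>
  have "(\<Sum>A\<in>?Q. \<Sum>x | x \<in> {x \<in> {1..n}. a q x \<noteq> x} \<and> {q \<in> Q. a q x = x} = A. 1 :: nat)
      = (\<Sum>x\<in>{x \<in> {1..n}. a q x \<noteq> x}. 1)"
    by (rule sum.group) (use Q in auto)
  moreover have "{x \<in> {x \<in> {1..n}. a q x \<noteq> x}. {q \<in> Q. a q x = x} = A}
      = {x \<in> {1..n}. {q \<in> Q. a q x = x} = A}" if "A \<in> ?Q" for A
    using that Q by auto
  ultimately have "card {x \<in> {1..n}. a q x \<noteq> x}
      = (\<Sum>A\<in>?Q. card {x \<in> {1..n}. {q \<in> Q. a q x = x} = A})"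
    by (simp only: card_eq_sum cong: sum.cong)
  then have "perm_dist n (a q) id = (\<Sum>A\<in>?Q. pmf (stab_distr n a Q) A)"
    by (simp add: perm_dist_def pmf_stab_distr[OF n] sum_divide_distrib)
  also have "\<dots> = (\<Sum>A\<in>?Q. \<bar>pmf (stab_distr n a Q) A - pmf (stab_distr n b Q) A\<bar>)"
    using b0 by simp
  also have "\<dots> \<le> (\<Sum>A\<in>Pow Q. \<bar>pmf (stab_distr n a Q) A - pmf (stab_distr n b Q) A\<bar>)"
    by (rule sum_mono2) (use Q in auto)
  finally show ?thesis
    by (simp add: tv_dist_def)
qed


section \<open>Presented groups\<close>

locale presentation =
  fixes S :: "'s set" and E :: "'s fword set"
  assumes relators: "E \<subseteq> carrier (free_group S)"
begin

abbreviation F :: "'s fword monoid" where "F \<equiv> free_group S"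
abbreviation K :: "'s fword set" where "K \<equiv> normal_closure (free_group S) E"
abbreviation \<Gamma> :: "'s fword set monoid" where "\<Gamma> \<equiv> presented_group S E"

sublocale F: group F
  by (rule free_group_group)

sublocale K: normal K F
proof -
  \<comment> \<open>The whole group shows that the family being intersected is nonempty.\<close>
  have carrier: "carrier F \<lhd> F"
    using F.subgroup_self by (simp add: F.normal_inv_iff)
  have "subgroup K F"
    unfolding normal_closure_def
    by (rule F.subgroups_Inter) (use carrier relators in \<open>auto intro: normal_imp_subgroup\<close>)
  moreover have "x \<otimes>\<^bsub>F\<^esub> h \<otimes>\<^bsub>F\<^esub> inv\<^bsub>F\<^esub> x \<in> K" if "x \<in> carrier F" "h \<in> K" for x h
    using that by (auto simp: normal_closure_def intro: normal.inv_op_closed2)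
  ultimately show "K \<lhd> F"
    by (simp add: F.normal_inv_iff)
qed

sublocale \<Gamma>: group \<Gamma>
  unfolding presented_group_def by (rule K.factorgroup_is_group)

definition proj :: "'s fword \<Rightarrow> 's fword set" where
  "proj w = K #>\<^bsub>F\<^esub> w"

text \<open>An arbitrary section of \<open>proj\<close>, which need not be multiplicative;
  \<open>hom_rep\<close> recovers multiplicativity after applying a homomorphism that kills the
  relators.\<close>

definition rep :: "'s fword set \<Rightarrow> 's fword" where
  "rep \<gamma> = (SOME w. w \<in> carrier F \<and> proj w = \<gamma>)"

sublocale proj: group_hom F \<Gamma> proj
proof -
  have "proj \<in> hom F \<Gamma>"
    using K.r_coset_hom_Mod by (simp add: proj_def[abs_def] presented_group_def)
  then show "group_hom F \<Gamma> proj"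
    by (simp add: group_hom_def group_hom_axioms_def F.is_group \<Gamma>.is_group)
qed

lemma rep:
  assumes "\<gamma> \<in> carrier \<Gamma>"
  shows rep_carrier: "rep \<gamma> \<in> carrier F" and proj_rep: "proj (rep \<gamma>) = \<gamma>"
proof -
  have "\<exists>w. w \<in> carrier F \<and> proj w = \<gamma>"
    using assms by (auto simp: presented_group_def FactGroup_def RCOSETS_def proj_def)
  then have "rep \<gamma> \<in> carrier F \<and> proj (rep \<gamma>) = \<gamma>"
    unfolding rep_def by (rule someI_ex)
  then show "rep \<gamma> \<in> carrier F" "proj (rep \<gamma>) = \<gamma>" by auto
qed

lemma proj_relator:
  assumes "w \<in> E"
  shows "proj w = \<one>\<^bsub>\<Gamma>\<^esub>"
proof -
  have "w \<in> K" using assms by (auto simp: normal_closure_def)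
  then show ?thesis
    by (simp add: proj_def presented_group_def FactGroup_def F.coset_join2 K.subset[THEN subsetD] K.is_subgroup)
qed

lemma gen_carrier: "s \<in> S \<Longrightarrow> [(s, True)] \<in> carrier F"
  by (auto simp: free_group_def)

lemma word_letters: "w \<in> carrier F \<Longrightarrow> set w \<subseteq> S \<times> UNIV"
  by (simp add: free_group_def)

text \<open>The kernel of \<open>\<phi>\<close> is a normal subgroup containing \<open>E\<close>,
  hence contains \<open>K\<close>, so \<open>\<phi>\<close> is constant on the cosets of
  \<open>K\<close>.\<close>

lemma hom_proj_cong:
  assumes "group G" "\<phi> \<in> hom F G" "\<And>w. w \<in> E \<Longrightarrow> \<phi> w = \<one>\<^bsub>G\<^esub>"
    and u: "u \<in> carrier F" and v: "v \<in> carrier F" and eq: "proj u = proj v"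
  shows "\<phi> u = \<phi> v"
proof -
  interpret \<phi>: group_hom F G \<phi>
    using assms by (simp add: group_hom_def group_hom_axioms_def F.is_group)
  have "E \<subseteq> kernel F G \<phi>"
    using relators assms(3) by (auto simp: kernel_def)
  then have "K \<subseteq> kernel F G \<phi>"
    using \<phi>.normal_kernel unfolding normal_closure_def by blast
  moreover have "u \<in> K #>\<^bsub>F\<^esub> v"
    using F.rcos_self[OF u K.is_subgroup] eq by (simp add: proj_def)
  then obtain z where "z \<in> K" "u = z \<otimes>\<^bsub>F\<^esub> v"
    by (auto simp: r_coset_def)
  ultimately show ?thesis
    using v K.subset by (auto simp: kernel_def)
qed

text \<open>The representative of a product and the product of the representatives lie in the same
  coset of \<open>K\<close>, so \<open>\<phi>\<close> cannot distinguish them.\<close>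

lemma hom_rep:
  assumes "group G" "\<phi> \<in> hom F G" "\<And>w. w \<in> E \<Longrightarrow> \<phi> w = \<one>\<^bsub>G\<^esub>"
  shows "(\<lambda>\<gamma>. \<phi> (rep \<gamma>)) \<in> hom \<Gamma> G"
proof (rule homI)
  interpret \<phi>: group_hom F G \<phi>
    using assms by (simp add: group_hom_def group_hom_axioms_def F.is_group)
  fix \<gamma> assume \<gamma>: "\<gamma> \<in> carrier \<Gamma>"
  then show "\<phi> (rep \<gamma>) \<in> carrier G"
    by (simp add: rep_carrier)
  fix \<delta> assume \<delta>: "\<delta> \<in> carrier \<Gamma>"
  have "\<phi> (rep (\<gamma> \<otimes>\<^bsub>\<Gamma>\<^esub> \<delta>)) = \<phi> (rep \<gamma> \<otimes>\<^bsub>F\<^esub> rep \<delta>)"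
    by (rule hom_proj_cong[OF assms]) (use \<gamma> \<delta> in \<open>simp_all add: rep\<close>)
  then show "\<phi> (rep (\<gamma> \<otimes>\<^bsub>\<Gamma>\<^esub> \<delta>)) = \<phi> (rep \<gamma>) \<otimes>\<^bsub>G\<^esub> \<phi> (rep \<delta>)"
    using \<gamma> \<delta> by (simp add: rep_carrier)
qed

text \<open>\<open>h \<circ> proj\<close> is a homomorphism on the free group, determined by its
  values on generators.\<close>

lemma hom_proj:
  assumes "group G" "h \<in> hom \<Gamma> G" "w \<in> carrier F"
  shows "free_eval G (\<lambda>s\<in>S. h (proj [(s, True)])) w = h (proj w)"
proof -
  have "h \<circ> proj \<in> hom F G"
    using proj.homh assms(2) by (rule hom_compose)
  then have "(h \<circ> proj) w = free_eval G (\<lambda>s\<in>S. h (proj [(s, True)])) w"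
    by (rule group.free_eval_unique[OF assms(1)]) (use assms in auto)
  then show ?thesis by simp
qed

lemma Pi_restrict_proj:
  assumes "f \<in> carrier \<Gamma> \<rightarrow> A"
  shows "(\<lambda>s\<in>S. f (proj [(s, True)])) \<in> S \<rightarrow>\<^sub>E A"
  using assms gen_carrier by (auto intro!: funcset_mem[OF assms])

text \<open>Homomorphisms from \<open>\<Gamma>\<close> yield exact solutions by restriction to
  generators; \<open>hom_Sol\<close> goes the other way.\<close>

lemma Sol_hom:
  assumes "h \<in> hom \<Gamma> (sym_group n)"
  shows "(\<lambda>s\<in>S. h (proj [(s, True)])) \<in> Sol S E n"
proof -
  interpret h: group_hom \<Gamma> "sym_group n" h
    using assms by (simp add: group_hom_def group_hom_axioms_def sym_group_is_group \<Gamma>.is_group)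
  show ?thesis
    using relators hom_proj[OF sym_group_is_group assms] Pi_restrict_proj[of h "carrier (sym_group n)"]
    by (auto simp: Sol_def perm_tuples_def proj_relator)
qed

lemma hom_Sol:
  assumes "\<tau> \<in> Sol S E n"
  shows "free_eval (sym_group n) \<tau> \<in> hom F (sym_group n)"
    and "(\<lambda>\<gamma>. free_eval (sym_group n) \<tau> (rep \<gamma>)) \<in> hom \<Gamma> (sym_group n)"
proof -
  show *: "free_eval (sym_group n) \<tau> \<in> hom F (sym_group n)"
    using assms
    by (intro group.free_eval_hom sym_group_is_group) (auto simp: Sol_def perm_tuples_def)
  show "(\<lambda>\<gamma>. free_eval (sym_group n) \<tau> (rep \<gamma>)) \<in> hom \<Gamma> (sym_group n)"
    using assms by (intro hom_rep sym_group_is_group *) (auto simp: Sol_def)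
qed

end


section \<open>Rigidity and almost homomorphisms\<close>

lemma tendsto_0_if_le:
  fixes a b :: "nat \<Rightarrow> real"
  assumes "b \<longlonglongrightarrow> 0" "\<And>l. 0 \<le> a l" "\<And>l. a l \<le> b l"
  shows "a \<longlonglongrightarrow> 0"
  by (rule tendsto_sandwich[OF _ _ tendsto_const assms(1)]) (use assms in auto)

lemmas perm_dist_tendsto_0 = tendsto_0_if_le[OF _ perm_dist_nonneg]

lemma diagonal_sequence:
  assumes "\<And>m. \<forall>\<^sub>F l in sequentially. A l m"
  obtains k :: "nat \<Rightarrow> nat"
  where "filterlim k at_top sequentially" "\<forall>\<^sub>F l in sequentially. A l (k l)"
proof -
  \<comment> \<open>\<open>k l\<close> is the largest valid index up to \<open>l\<close>. The bound
    \<open>m \<le> l\<close> keeps the set finite, and the inserted 0 makes \<open>Max\<close>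
    meaningful if no index is valid.\<close>
  define k where "k l = Max (insert 0 {m. m \<le> l \<and> A l m})" for l
  have "\<forall>\<^sub>F l in sequentially. m \<le> k l" for m
    using assms[of m] eventually_ge_at_top[of m]
    by eventually_elim (simp add: k_def Max_ge_iff)
  \<comment> \<open>Once \<open>k l\<close> is at least 1 it is not the inserted 0, so it is an
    index for which \<open>A l\<close> holds.\<close>
  moreover from this[of 1] have "\<forall>\<^sub>F l in sequentially. A l (k l)"
  proof eventually_elim
    case (elim l)
    have "k l \<in> insert 0 {m. m \<le> l \<and> A l m}"
      unfolding k_def by (rule Max_in) auto
    then show ?case using elim by auto
  qed
  ultimately show ?thesis
    by (intro that) (auto simp: filterlim_at_top)
qed

section \<open>Exact solutions and non-solutions of bounded degree\<close>

lemma finite_perm_tuples: "finite S \<Longrightarrow> finite (perm_tuples S n)"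
  by (auto simp: perm_tuples_def sym_group_def intro!: finite_PiE finite_permutations)

lemma Sol_subset_Sol_near: "0 < \<epsilon> \<Longrightarrow> Sol S E n \<subseteq> Sol_near \<nu> S E \<epsilon> n"
proof
  fix \<sigma> assume "0 < \<epsilon>" "\<sigma> \<in> Sol S E n"
  moreover from this have "(\<Sum>s\<in>S. perm_dist n (\<sigma> s) (\<sigma> s)) < \<epsilon>"
    by (simp add: perm_dist_def)
  ultimately show "\<sigma> \<in> Sol_near \<nu> S E \<epsilon> n"
    unfolding Sol_near_def by (auto simp: Sol_def intro!: exI[of _ n] exI[of _ \<sigma>])
qed

text \<open>Below degree \<open>M\<close> there are only finitely many tuples, and one violated
  relator is chosen for each non-solution. Thus a finite set of test words suffices even for
  infinite \<open>E\<close>.\<close>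

lemma finite_nonsolution_witnesses:
  assumes "finite S"
  obtains W where "finite W" "W \<subseteq> E"
    "\<And>n \<sigma>. n < M \<Longrightarrow> \<sigma> \<in> perm_tuples S n - Sol S E n \<Longrightarrow>
      \<exists>w\<in>W. free_eval (sym_group n) \<sigma> w \<noteq> id"
proof -
  define T where "T = (SIGMA n:{..<M}. perm_tuples S n - Sol S E n)"
  have "\<exists>w\<in>E. free_eval (sym_group n) \<sigma> w \<noteq> id" if "(n, \<sigma>) \<in> T" for n \<sigma>
    using that by (auto simp: T_def Sol_def sym_group_one)
  then have "\<forall>t\<in>T. \<exists>w. w \<in> E \<and> free_eval (sym_group (fst t)) (snd t) w \<noteq> id"
    by force
  then obtain c where c: "\<And>t. t \<in> T \<Longrightarrow> c t \<in> E \<and> free_eval (sym_group (fst t)) (snd t) (c t) \<noteq> id"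
    unfolding bchoice_iff by blast
  show ?thesis
  proof
    show "finite (c ` T)"
      using finite_perm_tuples[OF assms] by (auto simp: T_def)
    show "c ` T \<subseteq> E"
      using c by auto
    show "\<exists>w\<in>c ` T. free_eval (sym_group n) \<sigma> w \<noteq> id"
      if "n < M" "\<sigma> \<in> perm_tuples S n - Sol S E n" for n \<sigma>
      using c[of "(n, \<sigma>)"] that by (auto simp: T_def)
  qed
qed

section \<open>The passage between tuples of permutations and almost homomorphisms\<close>

context presentation
begin

text \<open>By induction on the fixed word \<open>w\<close>: each letter adds its own error and one
  multiplicativity defect, and all of these tend to 0.\<close>

lemma almost_hom_word:
  fixes f :: "nat \<Rightarrow> 's fword set \<Rightarrow> nat \<Rightarrow> nat"
  assumes f: "\<And>l. f l \<in> carrier \<Gamma> \<rightarrow> carrier (sym_group (n l))"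
    and almost: "\<And>\<gamma> \<delta>. \<gamma> \<in> carrier \<Gamma> \<Longrightarrow> \<delta> \<in> carrier \<Gamma> \<Longrightarrow>
      (\<lambda>l. perm_dist (n l) (f l (\<gamma> \<otimes>\<^bsub>\<Gamma>\<^esub> \<delta>)) (f l \<gamma> \<otimes>\<^bsub>sym_group (n l)\<^esub> f l \<delta>)) \<longlonglongrightarrow> 0"
    and w: "w \<in> carrier F"
  shows "(\<lambda>l. perm_dist (n l)
    (free_eval (sym_group (n l)) (\<lambda>s\<in>S. f l (proj [(s, True)])) w) (f l (proj w))) \<longlonglongrightarrow> 0"
proof -
  note almost = almost[unfolded sym_group_mult]
  have perm: "f l \<gamma> permutes {1..n l}" if "\<gamma> \<in> carrier \<Gamma>" for l \<gamma>
    using funcset_mem[OF f that] by (simp add: sym_group_carrier)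
  \<comment> \<open>The defect at the pair of units is the distance from \<open>f l \<one>\<close>
    to its square; cancelling one factor on the right leaves the distance to
    \<open>id\<close>.\<close>
  have one: "(\<lambda>l. perm_dist (n l) id (f l \<one>\<^bsub>\<Gamma>\<^esub>)) \<longlonglongrightarrow> 0"
  proof -
    have "perm_dist (n l) (f l (\<one>\<^bsub>\<Gamma>\<^esub> \<otimes>\<^bsub>\<Gamma>\<^esub> \<one>\<^bsub>\<Gamma>\<^esub>)) (f l \<one>\<^bsub>\<Gamma>\<^esub> \<circ> f l \<one>\<^bsub>\<Gamma>\<^esub>) = perm_dist (n l) id (f l \<one>\<^bsub>\<Gamma>\<^esub>)" for l
      using perm_dist_comp_right[OF perm[OF \<Gamma>.one_closed], of l id "f l \<one>\<^bsub>\<Gamma>\<^esub>"] by simp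
    with almost[OF \<Gamma>.one_closed \<Gamma>.one_closed] show ?thesis by simp
  qed
  define letter where "letter l x = (if snd x then (\<lambda>s\<in>S. f l (proj [(s, True)])) (fst x)
    else inv\<^bsub>sym_group (n l)\<^esub> (\<lambda>s\<in>S. f l (proj [(s, True)])) (fst x))" for l x
  have letter: "(\<lambda>l. perm_dist (n l) (letter l x) (f l (proj [x]))) \<longlonglongrightarrow> 0" if x: "x \<in> S \<times> UNIV" for x
  proof (cases "snd x")
    case True
    then have "x = (fst x, True)" "fst x \<in> S"
      using x by auto
    then have "letter l x = f l (proj [x])" for l
      using True by (metis letter_def restrict_apply')
    then show ?thesis by (simp add: perm_dist_def)
  next
    case False
    have s: "fst x \<in> S" using x by auto
    have x_carrier: "[x] \<in> carrier F"
      using x by (auto simp: free_group_def)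
    let ?\<gamma> = "proj [(fst x, True)]" and ?\<delta> = "proj [x]"
    have \<gamma>: "?\<gamma> \<in> carrier \<Gamma>" and \<delta>: "?\<delta> \<in> carrier \<Gamma>"
      using x_carrier gen_carrier[OF s] by auto
    have "[x] \<otimes>\<^bsub>F\<^esub> [(fst x, True)] = \<one>\<^bsub>F\<^esub>"
      using False by (simp add: free_group_def letter_inv_def)
    then have \<delta>\<gamma>: "?\<delta> \<otimes>\<^bsub>\<Gamma>\<^esub> ?\<gamma> = \<one>\<^bsub>\<Gamma>\<^esub>"
      using x_carrier gen_carrier[OF s] by (metis proj.hom_mult proj.hom_one)
    \<comment> \<open>Composing with the image of the generator on the right turns the inverse
      letter into \<open>id\<close>. The product of the images of \<open>?\<delta>\<close> and
      \<open>?\<gamma>\<close> is then compared with the image of the unit.\<close>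
    have "perm_dist (n l) (letter l x) (f l ?\<delta>)
        \<le> perm_dist (n l) id (f l \<one>\<^bsub>\<Gamma>\<^esub>) + perm_dist (n l) (f l (?\<delta> \<otimes>\<^bsub>\<Gamma>\<^esub> ?\<gamma>)) (f l ?\<delta> \<circ> f l ?\<gamma>)" for l
    proof -
      have "letter l x = inv' (f l ?\<gamma>)"
        using False s perm[OF \<gamma>] by (simp add: letter_def sym_group_carrier)
      then have "perm_dist (n l) (letter l x) (f l ?\<delta>) = perm_dist (n l) id (f l ?\<delta> \<circ> f l ?\<gamma>)"
        using perm_dist_comp_right[OF perm[OF \<gamma>], of l "inv' (f l ?\<gamma>)" "f l ?\<delta>"]
          permutes_inv_o(2)[OF perm[OF \<gamma>]] by metis
      also have "\<dots> \<le> perm_dist (n l) id (f l \<one>\<^bsub>\<Gamma>\<^esub>) + perm_dist (n l) (f l \<one>\<^bsub>\<Gamma>\<^esub>) (f l ?\<delta> \<circ> f l ?\<gamma>)"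
        by (rule perm_dist_triangle)
      finally show ?thesis by (simp add: \<delta>\<gamma>)
    qed
    then show ?thesis
      by (rule perm_dist_tendsto_0[rotated]) (use tendsto_add[OF one almost[OF \<delta> \<gamma>]] in simp)
  qed
  show ?thesis
    using w
  proof (induction w)
    case Nil
    have "proj [] = \<one>\<^bsub>\<Gamma>\<^esub>"
      using proj.hom_one by (simp add: free_group_def)
    with one show ?case
      by (simp only: free_eval.simps sym_group_one)
  next
    case (Cons x w)
    then have x: "x \<in> S \<times> UNIV" "[x] \<in> carrier F" and w: "w \<in> carrier F"
      by (auto simp: free_group_def dest: reduced_ConsD)
    have "x # w = [x] \<otimes>\<^bsub>F\<^esub> w"
      using Cons.prems by (simp add: free_group_def reduced_Cons_reduced)
    then have proj: "proj (x # w) = proj [x] \<otimes>\<^bsub>\<Gamma>\<^esub> proj w"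
      using x w by simp
    let ?u = "\<lambda>l. free_eval (sym_group (n l)) (\<lambda>s\<in>S. f l (proj [(s, True)])) w"
    \<comment> \<open>The three errors come from the first letter, from the rest of the word, and
      from the defect of \<open>f l\<close> at the pair of their images.\<close>
    have bound: "perm_dist (n l) (letter l x \<circ> ?u l) (f l (proj (x # w)))
        \<le> perm_dist (n l) (letter l x) (f l (proj [x])) + perm_dist (n l) (?u l) (f l (proj w))
          + perm_dist (n l) (f l (proj [x] \<otimes>\<^bsub>\<Gamma>\<^esub> proj w)) (f l (proj [x]) \<circ> f l (proj w))" for l
    proof -
      have "?u l permutes {1..n l}"
        using Pi_restrict_proj[OF f] word_letters[OF w] by (intro free_eval_permutes) auto
      from perm_dist_comp[OF this, of "letter l x" "f l (proj [x])" "f l (proj w)"] show ?thesis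
        using perm_dist_triangle[of "n l" "letter l x \<circ> ?u l" "f l (proj (x # w))"
            "f l (proj [x]) \<circ> f l (proj w)"]
        unfolding proj perm_dist_commute[of _ _ "f l (proj [x]) \<circ> f l (proj w)"] by linarith
    qed
    have carrier: "proj [x] \<in> carrier \<Gamma>" "proj w \<in> carrier \<Gamma>"
      using x w by auto
    have "(\<lambda>l. perm_dist (n l) (letter l x \<circ> ?u l) (f l (proj (x # w)))) \<longlonglongrightarrow> 0"
      using tendsto_add[OF tendsto_add[OF letter[OF x(1)] Cons.IH[OF w]] almost[OF carrier]]
      unfolding add_0 by (rule perm_dist_tendsto_0) (rule bound)
    then show ?case
      unfolding free_eval.simps sym_group_mult letter_def .
  qed
qed

text \<open>Restricting \<open>f\<close> and \<open>g\<close> to generators gives tuples to which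
  rigidity applies; the nearby solutions it provides extend to the required homomorphisms.\<close>

lemma near_homs_if_rigid:
  fixes f g :: "nat \<Rightarrow> 's fword set \<Rightarrow> nat \<Rightarrow> nat"
  assumes S: "finite S" and rigid: "flexibly_BS_rigid \<nu> S E"
    and n: "\<And>l. 1 \<le> n l"
    and f: "\<And>l. f l \<in> carrier \<Gamma> \<rightarrow> carrier (sym_group (n l))"
    and almost: "\<And>\<gamma> \<delta>. \<gamma> \<in> carrier \<Gamma> \<Longrightarrow> \<delta> \<in> carrier \<Gamma> \<Longrightarrow>
      (\<lambda>l. perm_dist (n l) (f l (\<gamma> \<otimes>\<^bsub>\<Gamma>\<^esub> \<delta>)) (f l \<gamma> \<otimes>\<^bsub>sym_group (n l)\<^esub> f l \<delta>)) \<longlonglongrightarrow> 0"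
    and g: "\<And>l. g l \<in> hom \<Gamma> (sym_group (n l))"
    and tv: "\<And>Q. finite Q \<Longrightarrow> Q \<subseteq> carrier \<Gamma> \<Longrightarrow>
      (\<lambda>l. tv_dist (Pow Q) (stab_distr (n l) (f l) Q) (stab_distr (n l) (g l) Q)) \<longlonglongrightarrow> 0"
  obtains \<epsilon> :: "nat \<Rightarrow> real" and M :: "nat \<Rightarrow> nat" and h :: "nat \<Rightarrow> 's fword set \<Rightarrow> nat \<Rightarrow> nat"
  where "\<And>l. 0 < \<epsilon> l" "\<epsilon> \<longlonglongrightarrow> 0" "\<And>l. h l \<in> hom \<Gamma> (sym_group (M l))"
    "\<And>l. n l \<le> M l" "\<And>l. enat (M l) \<le> enat (n l) + \<nu> (\<epsilon> l) (n l)"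
    "\<And>\<gamma>. \<gamma> \<in> carrier \<Gamma> \<Longrightarrow> (\<lambda>l. perm_dist (n l) (f l \<gamma>) (h l \<gamma>)) \<longlonglongrightarrow> 0"
proof -
  define \<sigma> where "\<sigma> l = (\<lambda>s\<in>S. f l (proj [(s, True)]))" for l
  define \<tau> where "\<tau> l = (\<lambda>s\<in>S. g l (proj [(s, True)]))" for l
  have \<sigma>: "\<sigma> l \<in> S \<rightarrow>\<^sub>E carrier (sym_group (n l))" for l
    unfolding \<sigma>_def by (rule Pi_restrict_proj[OF f])
  have \<tau>: "\<tau> l \<in> Sol S E (n l)" for l
    unfolding \<tau>_def by (rule Sol_hom[OF g])
  have close: "(\<lambda>l. perm_dist (n l) (free_eval (sym_group (n l)) (\<sigma> l) w) (f l (proj w))) \<longlonglongrightarrow> 0"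
    if "w \<in> carrier F" for w
    unfolding \<sigma>_def by (rule almost_hom_word[OF f almost that])
  have tv_words: "(\<lambda>l. tv_dist (Pow P) (stab_distr (n l) (free_eval (sym_group (n l)) (\<sigma> l)) P)
      (stab_distr (n l) (free_eval (sym_group (n l)) (\<tau> l)) P)) \<longlonglongrightarrow> 0"
    if P: "finite P" "P \<subseteq> carrier F" for P
  proof (rule tendsto_0_if_le)
    \<comment> \<open>Replacing the words in \<open>\<sigma> l\<close> by
      \<open>f l \<circ> proj\<close> costs the sum; comparing \<open>f l \<circ> proj\<close> with
      \<open>g l \<circ> proj\<close>, which agrees with evaluation at \<open>\<tau> l\<close>,
      costs the second term.\<close>
    let ?b = "\<lambda>l. (\<Sum>w\<in>P. perm_dist (n l) (free_eval (sym_group (n l)) (\<sigma> l) w) (f l (proj w)))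
      + tv_dist (Pow (proj ` P)) (stab_distr (n l) (f l) (proj ` P)) (stab_distr (n l) (g l) (proj ` P))"
    have "?b \<longlonglongrightarrow> (\<Sum>w\<in>P. 0) + 0"
      by (intro tendsto_add tendsto_sum close tv) (use P in auto)
    then show "?b \<longlonglongrightarrow> 0" by simp
    fix l
    let ?D = "\<lambda>a. stab_distr (n l) a P"
    have \<tau>_eq: "?D (free_eval (sym_group (n l)) (\<tau> l)) = ?D (g l \<circ> proj)"
      by (rule stab_distr_cong[OF n])
        (use P hom_proj[OF sym_group_is_group g] in \<open>auto simp: \<tau>_def\<close>)
    have "tv_dist (Pow P) (?D (free_eval (sym_group (n l)) (\<sigma> l))) (?D (f l \<circ> proj))
        \<le> (\<Sum>w\<in>P. perm_dist (n l) (free_eval (sym_group (n l)) (\<sigma> l) w) (f l (proj w)))"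
      using tv_dist_stab_distr_le_perm_dist[OF n P(1), of l "free_eval (sym_group (n l)) (\<sigma> l)" "f l \<circ> proj"]
      by simp
    moreover have "tv_dist (Pow P) (?D (f l \<circ> proj)) (?D (g l \<circ> proj))
        \<le> tv_dist (Pow (proj ` P)) (stab_distr (n l) (f l) (proj ` P)) (stab_distr (n l) (g l) (proj ` P))"
      by (rule tv_dist_stab_distr_comp_le[OF n]) (use P in auto)
    ultimately show "tv_dist (Pow P) (?D (free_eval (sym_group (n l)) (\<sigma> l)))
        (?D (free_eval (sym_group (n l)) (\<tau> l))) \<le> ?b l"
      using tv_dist_triangle[of "Pow P" "?D (free_eval (sym_group (n l)) (\<sigma> l))" "?D (g l \<circ> proj)" "?D (f l \<circ> proj)"]
      by (simp add: \<tau>_eq)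
  qed (rule tv_dist_nonneg)
  have "\<forall>\<^sub>F l in sequentially. \<sigma> l \<in> Sol_near \<nu> S E (1 / real (Suc m)) (n l)" for m
  proof -
    \<comment> \<open>The test set and threshold depend on \<open>m\<close> alone, so the distance
      over \<open>P\<close> eventually drops below \<open>\<delta>\<close> and excludes a far
      tuple.\<close>
    obtain P \<delta> where P: "finite P" "P \<subseteq> carrier F" and \<delta>: "\<delta> > 0"
      and far: "\<And>n \<sigma> \<tau>. 1 \<le> n \<Longrightarrow> \<sigma> \<in> Sol_far \<nu> S E (1 / real (Suc m)) n \<Longrightarrow> \<tau> \<in> Sol S E n \<Longrightarrow>
        \<delta> \<le> tv_dist (Pow P) (stab_distr n (free_eval (sym_group n) \<sigma>) P)
          (stab_distr n (free_eval (sym_group n) \<tau>) P)"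
      using rigid[unfolded flexibly_BS_rigid_def, rule_format, of "1 / real (Suc m)"] by auto
    from order_tendstoD(2)[OF tv_words[OF P] \<delta>] show ?thesis
    proof eventually_elim
      case (elim l)
      then have "\<sigma> l \<notin> Sol_far \<nu> S E (1 / real (Suc m)) (n l)"
        using far[OF n _ \<tau>, of "\<sigma> l" l] by auto
      then show ?case
        using \<sigma> by (auto simp: Sol_far_def perm_tuples_def)
    qed
  qed
  then obtain k where k: "filterlim k at_top sequentially"
    and near: "\<forall>\<^sub>F l in sequentially. \<sigma> l \<in> Sol_near \<nu> S E (1 / real (Suc (k l))) (n l)"
    by (rule diagonal_sequence)
  \<comment> \<open>\<open>Suc\<close> keeps \<open>\<epsilon> l\<close> positive also where
    \<open>k l = 0\<close>.\<close>
  define \<epsilon> where "\<epsilon> l = 1 / real (Suc (k l))" for l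
  have \<epsilon>: "\<epsilon> \<longlonglongrightarrow> 0"
    unfolding \<epsilon>_def[abs_def] using filterlim_compose[OF lim_1_over_n[THEN LIMSEQ_Suc] k] by simp
  have "(\<lambda>_. id) \<in> hom \<Gamma> (sym_group N)" for N
    by (rule homI) (auto simp: sym_group_def permutes_id)
  from Sol_hom[OF this] have nonempty: "\<exists>\<rho>. \<rho> \<in> Sol S E N" for N
    by blast
  \<comment> \<open>The degree bounds must hold for every \<open>l\<close>, whereas closeness is
    available only eventually; hence the implication. In the remaining cases any solution of degree
    \<open>n l\<close> serves, and the trivial homomorphism shows that one exists.\<close>
  define good where "good l M \<rho> \<longleftrightarrow> n l \<le> M \<and> enat M \<le> enat (n l) + \<nu> (\<epsilon> l) (n l) \<and> \<rho> \<in> Sol S E M \<and>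
      (\<sigma> l \<in> Sol_near \<nu> S E (\<epsilon> l) (n l) \<longrightarrow> (\<Sum>s\<in>S. perm_dist (n l) (\<sigma> l s) (\<rho> s)) < \<epsilon> l)" for l M \<rho>
  have "\<exists>M \<rho>. good l M \<rho>" for l
  proof (cases "\<sigma> l \<in> Sol_near \<nu> S E (\<epsilon> l) (n l)")
    case True
    then show ?thesis
      unfolding good_def Sol_near_def by blast
  next
    case False
    obtain \<rho> where "\<rho> \<in> Sol S E (n l)"
      using nonempty by blast
    with False have "good l (n l) \<rho>"
      by (simp add: good_def)
    then show ?thesis by blast
  qed
  then obtain M \<rho> where good: "\<And>l. good l (M l) (\<rho> l)"
    by metis
  then have M: "\<And>l. n l \<le> M l" "\<And>l. enat (M l) \<le> enat (n l) + \<nu> (\<epsilon> l) (n l)"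
    and \<rho>: "\<And>l. \<rho> l \<in> Sol S E (M l)"
    and dist: "\<And>l. \<sigma> l \<in> Sol_near \<nu> S E (\<epsilon> l) (n l) \<Longrightarrow>
      (\<Sum>s\<in>S. perm_dist (n l) (\<sigma> l s) (\<rho> l s)) < \<epsilon> l"
    by (simp_all add: good_def)
  have sum0: "(\<lambda>l. \<Sum>s\<in>S. perm_dist (n l) (\<sigma> l s) (\<rho> l s)) \<longlonglongrightarrow> 0"
  proof (rule tendsto_sandwich[OF _ _ tendsto_const \<epsilon>])
    show "\<forall>\<^sub>F l in sequentially. (\<Sum>s\<in>S. perm_dist (n l) (\<sigma> l s) (\<rho> l s)) \<le> \<epsilon> l"
      using near unfolding \<epsilon>_def[symmetric] by eventually_elim (rule less_imp_le[OF dist])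
  qed (simp add: sum_nonneg perm_dist_nonneg)
  show ?thesis
  proof (rule that[of \<epsilon> "\<lambda>l \<gamma>. free_eval (sym_group (M l)) (\<rho> l) (rep \<gamma>)" M])
    fix \<gamma> assume \<gamma>: "\<gamma> \<in> carrier \<Gamma>"
    let ?w = "rep \<gamma>"
    have w: "?w \<in> carrier F" "proj ?w = \<gamma>"
      using rep[OF \<gamma>] by auto
    show "(\<lambda>l. perm_dist (n l) (f l \<gamma>) (free_eval (sym_group (M l)) (\<rho> l) ?w)) \<longlonglongrightarrow> 0"
    proof (rule perm_dist_tendsto_0)
      \<comment> \<open>The representative \<open>?w\<close> does not depend on \<open>l\<close>, so
        its length is a constant factor in front of a null sequence.\<close>
      let ?b = "\<lambda>l. perm_dist (n l) (free_eval (sym_group (n l)) (\<sigma> l) ?w) (f l (proj ?w))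
        + real (length ?w) * (\<Sum>s\<in>S. perm_dist (n l) (\<sigma> l s) (\<rho> l s))"
      have "?b \<longlonglongrightarrow> 0 + real (length ?w) * 0"
        by (intro tendsto_add tendsto_mult tendsto_const close sum0 w)
      then show "?b \<longlonglongrightarrow> 0" by simp
      fix l
      have "perm_dist (n l) (free_eval (sym_group (n l)) (\<sigma> l) ?w) (free_eval (sym_group (M l)) (\<rho> l) ?w)
          \<le> real (length ?w) * (\<Sum>s\<in>S. perm_dist (n l) (\<sigma> l s) (\<rho> l s))"
        by (rule perm_dist_free_eval)
          (use \<sigma>[of l] \<rho>[of l] S word_letters[OF w(1)] in \<open>auto simp: Sol_def perm_tuples_def\<close>)
      then show "perm_dist (n l) (f l \<gamma>) (free_eval (sym_group (M l)) (\<rho> l) ?w) \<le> ?b l"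
        using perm_dist_triangle[of "n l" "f l \<gamma>" "free_eval (sym_group (M l)) (\<rho> l) ?w"
            "free_eval (sym_group (n l)) (\<sigma> l) ?w"]
          perm_dist_commute[of "n l" "f l \<gamma>" "free_eval (sym_group (n l)) (\<sigma> l) ?w"]
        unfolding w(2) by linarith
    qed
  qed (use \<epsilon> M hom_Sol[OF \<rho>] in \<open>auto simp: \<epsilon>_def\<close>)
qed

text \<open>Failure of rigidity is tested on balls of words, which exhaust the free group; adding
  violated relators to the test set forces the degrees to grow.\<close>

lemma far_sequence_if_not_rigid:
  assumes S: "finite S" and "\<not> flexibly_BS_rigid \<nu> S E"
  obtains \<epsilon> :: real and n :: "nat \<Rightarrow> nat" and \<sigma> \<tau> :: "nat \<Rightarrow> 's \<Rightarrow> nat \<Rightarrow> nat"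
  where "0 < \<epsilon>" "\<And>l. 1 \<le> n l" "filterlim n at_top sequentially"
    "\<And>l. \<sigma> l \<in> Sol_far \<nu> S E \<epsilon> (n l)" "\<And>l. \<tau> l \<in> Sol S E (n l)"
    "\<And>P. finite P \<Longrightarrow> P \<subseteq> carrier F \<Longrightarrow>
      (\<lambda>l. tv_dist (Pow P) (stab_distr (n l) (free_eval (sym_group (n l)) (\<sigma> l)) P)
        (stab_distr (n l) (free_eval (sym_group (n l)) (\<tau> l)) P)) \<longlonglongrightarrow> 0"
proof -
  define tv where "tv n P \<sigma> \<tau> = tv_dist (Pow P) (stab_distr n (free_eval (sym_group n) \<sigma>) P)
    (stab_distr n (free_eval (sym_group n) \<tau>) P)" for n P \<sigma> and \<tau> :: "'s \<Rightarrow> nat \<Rightarrow> nat"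
  obtain \<epsilon> where \<epsilon>: "\<epsilon> > 0" and far: "\<And>P \<delta>. finite P \<Longrightarrow> P \<subseteq> carrier F \<Longrightarrow> \<delta> > 0 \<Longrightarrow>
      \<exists>n\<ge>1. \<exists>\<sigma>\<in>Sol_far \<nu> S E \<epsilon> n. \<exists>\<tau>\<in>Sol S E n. tv n P \<sigma> \<tau> < \<delta>"
    using assms(2) unfolding flexibly_BS_rigid_def tv_def by (meson not_le)
  have large: "\<exists>n \<sigma> \<tau>. 1 \<le> n \<and> M \<le> n \<and> \<sigma> \<in> Sol_far \<nu> S E \<epsilon> n \<and> \<tau> \<in> Sol S E n \<and> tv n P \<sigma> \<tau> < \<delta>"
    if P: "finite P" "P \<subseteq> carrier F" and \<delta>: "\<delta> > 0" for P \<delta> M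
  proof -
    obtain W where W: "finite W" "W \<subseteq> E"
      and wit: "\<And>n \<sigma>. n < M \<Longrightarrow> \<sigma> \<in> perm_tuples S n - Sol S E n \<Longrightarrow>
        \<exists>w\<in>W. free_eval (sym_group n) \<sigma> w \<noteq> id"
      using finite_nonsolution_witnesses[OF S] by metis
    \<comment> \<open>The 2 offsets the factor in \<open>perm_dist_id_le_tv_dist\<close>.
      \<open>Suc M\<close> keeps the denominator positive for \<open>M = 0\<close> and makes the
      bound smaller than \<open>1 / n\<close> for every \<open>n\<close> with
      \<open>1 \<le> n < M\<close>.\<close>
    let ?\<delta> = "min \<delta> (1 / (2 * real (Suc M)))"
    have "finite (P \<union> W)" "P \<union> W \<subseteq> carrier F" "?\<delta> > 0"
      using P W \<delta> relators by auto
    from far[OF this] obtain n \<sigma> \<tau> where n: "1 \<le> n" and \<sigma>: "\<sigma> \<in> Sol_far \<nu> S E \<epsilon> n"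
      and \<tau>: "\<tau> \<in> Sol S E n" and small: "tv n (P \<union> W) \<sigma> \<tau> < ?\<delta>"
      by blast
    have "\<not> n < M"
    proof
      assume "n < M"
      \<comment> \<open>Exact solutions are near themselves, so a far tuple violates some
        relator.\<close>
      moreover have \<sigma>': "\<sigma> \<in> perm_tuples S n - Sol S E n"
        using \<sigma> Sol_subset_Sol_near[OF \<epsilon>, of S E n \<nu>] by (auto simp: Sol_far_def)
      ultimately obtain w where w: "w \<in> W" "free_eval (sym_group n) \<sigma> w \<noteq> id"
        using wit by blast
      have "\<sigma> \<in> S \<rightarrow> carrier (sym_group n)" "w \<in> carrier F"
        using \<sigma>' w W relators by (auto simp: perm_tuples_def)
      then have "free_eval (sym_group n) \<sigma> w permutes {1..n}"
        using word_letters by (intro free_eval_permutes)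
      then have "1 / real n \<le> perm_dist n (free_eval (sym_group n) \<sigma> w) id"
        using w(2) by (rule perm_dist_id_ge)
      also have "\<dots> \<le> 2 * tv n (P \<union> W) \<sigma> \<tau>"
        unfolding tv_def using \<tau> w(1) W P
        by (intro perm_dist_id_le_tv_dist[OF n]) (auto simp: Sol_def sym_group_one)
      also have "\<dots> < 1 / real (Suc M)"
        using small by (simp add: field_simps)
      also have "\<dots> < 1 / real n"
        using n \<open>n < M\<close> by (intro divide_strict_left_mono) auto
      finally show False .
    qed
    moreover have "tv n P \<sigma> \<tau> \<le> tv n (P \<union> W) \<sigma> \<tau>"
      unfolding tv_def by (rule tv_dist_stab_distr_mono[OF n]) (use P W in auto)
    ultimately show ?thesis
      using n \<sigma> \<tau> small by (intro exI[of _ n] exI[of _ \<sigma>] exI[of _ \<tau>]) auto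
  qed
  \<comment> \<open>These balls are finite because \<open>S\<close> is, and a finite set of words
    lies in all balls of sufficiently large radius.\<close>
  define B where "B l = {w \<in> carrier F. length w \<le> l}" for l
  have B: "finite (B l)" "B l \<subseteq> carrier F" for l
  proof -
    have "finite {w. set w \<subseteq> S \<times> (UNIV :: bool set) \<and> length w \<le> l}"
      by (rule finite_lists_length_le) (use S in simp)
    then show "finite (B l)"
      by (rule rev_finite_subset) (auto simp: B_def dest: word_letters)
  qed (auto simp: B_def)
  have "\<exists>n \<sigma> \<tau>. 1 \<le> n \<and> l \<le> n \<and> \<sigma> \<in> Sol_far \<nu> S E \<epsilon> n \<and> \<tau> \<in> Sol S E n \<and>
      tv n (B l) \<sigma> \<tau> < 1 / real (Suc l)" for l
    by (rule large[OF B]) simp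
  then obtain n \<sigma> \<tau> where n: "\<And>l. 1 \<le> n l" "\<And>l. l \<le> n l"
    and \<sigma>: "\<And>l. \<sigma> l \<in> Sol_far \<nu> S E \<epsilon> (n l)" and \<tau>: "\<And>l. \<tau> l \<in> Sol S E (n l)"
    and small: "\<And>l. tv (n l) (B l) (\<sigma> l) (\<tau> l) < 1 / real (Suc l)"
    by metis
  show ?thesis
  proof (rule that[OF \<epsilon> n(1) _ \<sigma> \<tau>])
    show "filterlim n at_top sequentially"
      by (rule filterlim_at_top_mono[OF filterlim_ident]) (use n in auto)
    fix P assume P: "finite P" "P \<subseteq> carrier F"
    obtain L where L: "\<And>w. w \<in> P \<Longrightarrow> length w \<le> L"
      using P(1) by (meson finite_imageI finite_nat_set_iff_bounded_le imageI)
    have "(\<lambda>l. tv (n l) P (\<sigma> l) (\<tau> l)) \<longlonglongrightarrow> 0"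
    proof (rule tendsto_sandwich[OF _ _ tendsto_const])
      show "(\<lambda>l. 1 / real (Suc l)) \<longlonglongrightarrow> 0"
        by (rule lim_1_over_n[THEN LIMSEQ_Suc])
      show "\<forall>\<^sub>F l in sequentially. tv (n l) P (\<sigma> l) (\<tau> l) \<le> 1 / real (Suc l)"
        using eventually_ge_at_top[of L]
      proof eventually_elim
        case (elim l)
        have "P \<subseteq> B l"
          using L P elim by (force simp: B_def)
        then have "tv (n l) P (\<sigma> l) (\<tau> l) \<le> tv (n l) (B l) (\<sigma> l) (\<tau> l)"
          unfolding tv_def by (rule tv_dist_stab_distr_mono[OF n(1)]) (rule B)
        with small[of l] show ?case by simp
      qed
    qed (simp add: tv_def tv_dist_nonneg)
    then show "(\<lambda>l. tv_dist (Pow P) (stab_distr (n l) (free_eval (sym_group (n l)) (\<sigma> l)) P)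
        (stab_distr (n l) (free_eval (sym_group (n l)) (\<tau> l)) P)) \<longlonglongrightarrow> 0"
      by (simp add: tv_def)
  qed
qed

text \<open>\<open>f\<close> and \<open>g\<close> evaluate the far tuples and the exact solutions at
  representatives. The choice of representative affects \<open>f\<close> only by an error tending to
  0, which also makes \<open>f\<close> almost multiplicative.\<close>

lemma almost_hom_if_not_rigid:
  assumes S: "finite S" and "\<not> flexibly_BS_rigid \<nu> S E"
  obtains \<epsilon> :: real and n :: "nat \<Rightarrow> nat" and \<sigma> :: "nat \<Rightarrow> 's \<Rightarrow> nat \<Rightarrow> nat"
    and f g :: "nat \<Rightarrow> 's fword set \<Rightarrow> nat \<Rightarrow> nat"
  where "0 < \<epsilon>" "\<And>l. 1 \<le> n l" "filterlim n at_top sequentially"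
    "\<And>l. \<sigma> l \<in> Sol_far \<nu> S E \<epsilon> (n l)"
    "\<And>s. s \<in> S \<Longrightarrow> (\<lambda>l. perm_dist (n l) (\<sigma> l s) (f l (proj [(s, True)]))) \<longlonglongrightarrow> 0"
    "\<And>l. f l \<in> carrier \<Gamma> \<rightarrow> carrier (sym_group (n l))"
    "\<And>\<gamma> \<delta>. \<gamma> \<in> carrier \<Gamma> \<Longrightarrow> \<delta> \<in> carrier \<Gamma> \<Longrightarrow>
      (\<lambda>l. perm_dist (n l) (f l (\<gamma> \<otimes>\<^bsub>\<Gamma>\<^esub> \<delta>)) (f l \<gamma> \<otimes>\<^bsub>sym_group (n l)\<^esub> f l \<delta>)) \<longlonglongrightarrow> 0"
    "\<And>l. g l \<in> hom \<Gamma> (sym_group (n l))"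
    "\<And>Q. finite Q \<Longrightarrow> Q \<subseteq> carrier \<Gamma> \<Longrightarrow>
      (\<lambda>l. tv_dist (Pow Q) (stab_distr (n l) (f l) Q) (stab_distr (n l) (g l) Q)) \<longlonglongrightarrow> 0"
proof -
  obtain \<epsilon> n and \<sigma> \<tau> :: "nat \<Rightarrow> 's \<Rightarrow> nat \<Rightarrow> nat"
    where \<epsilon>: "0 < \<epsilon>" and n: "\<And>l. 1 \<le> n l" "filterlim n at_top sequentially"
      and far: "\<And>l. \<sigma> l \<in> Sol_far \<nu> S E \<epsilon> (n l)" and \<tau>: "\<And>l. \<tau> l \<in> Sol S E (n l)"
      and tv: "\<And>P. finite P \<Longrightarrow> P \<subseteq> carrier F \<Longrightarrow>
        (\<lambda>l. tv_dist (Pow P) (stab_distr (n l) (free_eval (sym_group (n l)) (\<sigma> l)) P)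
          (stab_distr (n l) (free_eval (sym_group (n l)) (\<tau> l)) P)) \<longlonglongrightarrow> 0"
    by (rule far_sequence_if_not_rigid[OF assms]) blast
  define ev where "ev l = free_eval (sym_group (n l)) (\<sigma> l)" for l
  have \<sigma>: "\<sigma> l \<in> S \<rightarrow> carrier (sym_group (n l))" for l
    using far[of l] by (auto simp: Sol_far_def perm_tuples_def)
  have ev_hom: "ev l \<in> hom F (sym_group (n l))" for l
    unfolding ev_def by (rule group.free_eval_hom[OF sym_group_is_group \<sigma>])
  have ev_perm: "ev l w permutes {1..n l}" if "w \<in> carrier F" for l w
    unfolding ev_def by (rule free_eval_permutes[OF \<sigma> word_letters[OF that]])
  have ev_mult: "ev l (u \<otimes>\<^bsub>F\<^esub> v) = ev l u \<circ> ev l v" if "u \<in> carrier F" "v \<in> carrier F" for l u v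
    using hom_mult[OF ev_hom that] by (simp add: sym_group_mult)
  have close: "(\<lambda>l. perm_dist (n l) (ev l u) (ev l v)) \<longlonglongrightarrow> 0"
    if u: "u \<in> carrier F" and v: "v \<in> carrier F" and eq: "proj u = proj v" for u v
  proof (rule perm_dist_tendsto_0)
    \<comment> \<open>With the quotient on the right, cancelling \<open>ev l v\<close> on the left
      leaves the distance of \<open>ev l w\<close> from \<open>id\<close>. As \<open>w\<close> is
      trivial in \<open>\<Gamma>\<close>, the exact solution sends it to \<open>id\<close>, so the
      test set \<open>{w}\<close> controls this distance.\<close>
    define w where "w = inv\<^bsub>F\<^esub> v \<otimes>\<^bsub>F\<^esub> u"
    have w: "w \<in> carrier F" "u = v \<otimes>\<^bsub>F\<^esub> w"
      using u v by (auto simp: w_def F.m_assoc[symmetric])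
    have "proj w = proj \<one>\<^bsub>F\<^esub>"
      using u v eq by (simp add: w_def)
    then have one: "free_eval (sym_group (n l)) (\<tau> l) w = id" for l
      using hom_proj_cong[OF sym_group_is_group hom_Sol(1)[OF \<tau>[of l]] _ w(1) F.one_closed] \<tau>[of l]
      by (simp add: Sol_def sym_group_one free_group_def)
    let ?b = "\<lambda>l. 2 * tv_dist (Pow {w}) (stab_distr (n l) (free_eval (sym_group (n l)) (\<sigma> l)) {w})
          (stab_distr (n l) (free_eval (sym_group (n l)) (\<tau> l)) {w})"
    show "?b \<longlonglongrightarrow> 0"
      using tendsto_mult_left[OF tv[of "{w}"], of 2] w by simp
    fix l
    have "perm_dist (n l) (ev l u) (ev l v) = perm_dist (n l) (ev l w) id"
      using perm_dist_comp_left[OF permutes_inj[OF ev_perm[OF v]], of "n l" l "ev l w" id]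
        ev_mult[OF v w(1)] w(2) by simp
    also have "\<dots> \<le> ?b l"
      unfolding ev_def by (rule perm_dist_id_le_tv_dist) (use n one in auto)
    finally show "perm_dist (n l) (ev l u) (ev l v) \<le> ?b l" .
  qed
  show ?thesis
  proof (rule that[of \<epsilon> n \<sigma> "\<lambda>l \<gamma>. ev l (rep \<gamma>)" "\<lambda>l \<gamma>. free_eval (sym_group (n l)) (\<tau> l) (rep \<gamma>)"])
    fix s assume s: "s \<in> S"
    have "\<sigma> l s = ev l [(s, True)]" for l
      unfolding ev_def by (rule group.free_eval_gen[OF sym_group_is_group \<sigma> s, symmetric])
    \<comment> \<open>The chosen representative of a generator's class may be another word, so
      \<open>f\<close> agrees with \<open>\<sigma>\<close> only in the limit.\<close>
    moreover have "(\<lambda>l. perm_dist (n l) (ev l [(s, True)]) (ev l (rep (proj [(s, True)])))) \<longlonglongrightarrow> 0"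
      by (rule close) (simp_all add: gen_carrier[OF s] rep)
    ultimately show "(\<lambda>l. perm_dist (n l) (\<sigma> l s) (ev l (rep (proj [(s, True)])))) \<longlonglongrightarrow> 0"
      by simp
  next
    fix \<gamma> \<delta> assume *: "\<gamma> \<in> carrier \<Gamma>" "\<delta> \<in> carrier \<Gamma>"
    then have "(\<lambda>l. perm_dist (n l) (ev l (rep (\<gamma> \<otimes>\<^bsub>\<Gamma>\<^esub> \<delta>))) (ev l (rep \<gamma> \<otimes>\<^bsub>F\<^esub> rep \<delta>))) \<longlonglongrightarrow> 0"
      by (intro close) (simp_all add: rep)
    then show "(\<lambda>l. perm_dist (n l) (ev l (rep (\<gamma> \<otimes>\<^bsub>\<Gamma>\<^esub> \<delta>)))
        (ev l (rep \<gamma>) \<otimes>\<^bsub>sym_group (n l)\<^esub> ev l (rep \<delta>))) \<longlonglongrightarrow> 0"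
      unfolding sym_group_mult ev_mult[OF rep_carrier[OF *(1)] rep_carrier[OF *(2)]] .
  next
    fix Q assume Q: "finite Q" "Q \<subseteq> carrier \<Gamma>"
    show "(\<lambda>l. tv_dist (Pow Q) (stab_distr (n l) (\<lambda>\<gamma>. ev l (rep \<gamma>)) Q)
        (stab_distr (n l) (\<lambda>\<gamma>. free_eval (sym_group (n l)) (\<tau> l) (rep \<gamma>)) Q)) \<longlonglongrightarrow> 0"
    proof (rule tendsto_0_if_le[OF tv[of "rep ` Q"] tv_dist_nonneg])
      show "tv_dist (Pow Q) (stab_distr (n l) (\<lambda>\<gamma>. ev l (rep \<gamma>)) Q)
          (stab_distr (n l) (\<lambda>\<gamma>. free_eval (sym_group (n l)) (\<tau> l) (rep \<gamma>)) Q)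
        \<le> tv_dist (Pow (rep ` Q)) (stab_distr (n l) (free_eval (sym_group (n l)) (\<sigma> l)) (rep ` Q))
          (stab_distr (n l) (free_eval (sym_group (n l)) (\<tau> l)) (rep ` Q))" for l
        using tv_dist_stab_distr_comp_le[OF n(1), of rep Q "rep ` Q" l] Q
        unfolding ev_def comp_def by simp
    qed (use Q rep_carrier in auto)
  qed (use \<epsilon> n far hom_Sol[OF \<tau>] ev_perm rep_carrier in \<open>auto simp: sym_group_carrier\<close>)
qed

end

theorem proposition1p19:
  fixes S :: "'s set"
    and E :: "'s fword set"
    and \<nu> :: "real \<Rightarrow> nat \<Rightarrow> enat"
  assumes "finite S"
    and "E \<subseteq> carrier (free_group S)"
    and "\<And>\<epsilon> \<epsilon>' n. 0 < \<epsilon> \<Longrightarrow> \<epsilon> \<le> \<epsilon>' \<Longrightarrow> 1 \<le> n \<Longrightarrow> \<nu> \<epsilon> n \<le> \<nu> \<epsilon>' n"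
  shows "flexibly_BS_rigid \<nu> S E \<longleftrightarrow>
    (\<forall>(n :: nat \<Rightarrow> nat) (f :: nat \<Rightarrow> 's fword set \<Rightarrow> nat \<Rightarrow> nat).
      (\<forall>l. 1 \<le> n l) \<longrightarrow>
      (\<forall>l. f l \<in> carrier (presented_group S E) \<rightarrow> carrier (sym_group (n l))) \<longrightarrow>
      filterlim n at_top sequentially \<longrightarrow>
      (\<forall>\<gamma>\<^sub>1\<in>carrier (presented_group S E). \<forall>\<gamma>\<^sub>2\<in>carrier (presented_group S E).
        (\<lambda>l. perm_dist (n l) (f l (\<gamma>\<^sub>1 \<otimes>\<^bsub>presented_group S E\<^esub> \<gamma>\<^sub>2))
                              (f l \<gamma>\<^sub>1 \<otimes>\<^bsub>sym_group (n l)\<^esub> f l \<gamma>\<^sub>2)) \<longlonglongrightarrow> 0) \<longrightarrow>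
      (\<exists>g :: nat \<Rightarrow> 's fword set \<Rightarrow> nat \<Rightarrow> nat.
        (\<forall>l. g l \<in> hom (presented_group S E) (sym_group (n l))) \<and>
        (\<forall>Q. finite Q \<and> Q \<subseteq> carrier (presented_group S E) \<longrightarrow>
          (\<lambda>l. tv_dist (Pow Q) (stab_distr (n l) (f l) Q) (stab_distr (n l) (g l) Q))
            \<longlonglongrightarrow> 0)) \<longrightarrow>
      (\<exists>(\<epsilon> :: nat \<Rightarrow> real) (N :: nat \<Rightarrow> nat) (h :: nat \<Rightarrow> 's fword set \<Rightarrow> nat \<Rightarrow> nat).
        (\<forall>l. 0 < \<epsilon> l) \<and> \<epsilon> \<longlonglongrightarrow> 0 \<and>
        (\<forall>l. h l \<in> hom (presented_group S E) (sym_group (N l))) \<and>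
        (\<forall>l. n l \<le> N l \<and> enat (N l) \<le> enat (n l) + \<nu> (\<epsilon> l) (n l)) \<and>
        (\<forall>\<gamma>\<in>carrier (presented_group S E).
          (\<lambda>l. perm_dist (n l) (f l \<gamma>) (h l \<gamma>)) \<longlonglongrightarrow> 0)))"
    (is "?rigid \<longleftrightarrow> ?stable")
proof -
  interpret presentation S E
    by (rule presentation.intro) (rule assms(2))
  show ?thesis
  proof (intro iffI allI impI)
    fix n :: "nat \<Rightarrow> nat" and f :: "nat \<Rightarrow> 's fword set \<Rightarrow> nat \<Rightarrow> nat"
    assume rigid: ?rigid and n: "\<forall>l. 1 \<le> n l"
      and f: "\<forall>l. f l \<in> carrier \<Gamma> \<rightarrow> carrier (sym_group (n l))"
      and almost: "\<forall>\<gamma>\<^sub>1\<in>carrier \<Gamma>. \<forall>\<gamma>\<^sub>2\<in>carrier \<Gamma>.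
        (\<lambda>l. perm_dist (n l) (f l (\<gamma>\<^sub>1 \<otimes>\<^bsub>\<Gamma>\<^esub> \<gamma>\<^sub>2)) (f l \<gamma>\<^sub>1 \<otimes>\<^bsub>sym_group (n l)\<^esub> f l \<gamma>\<^sub>2)) \<longlonglongrightarrow> 0"
    assume "\<exists>g. (\<forall>l. g l \<in> hom \<Gamma> (sym_group (n l))) \<and> (\<forall>Q. finite Q \<and> Q \<subseteq> carrier \<Gamma> \<longrightarrow>
      (\<lambda>l. tv_dist (Pow Q) (stab_distr (n l) (f l) Q) (stab_distr (n l) (g l) Q)) \<longlonglongrightarrow> 0)"
    then obtain g where g: "\<And>l. g l \<in> hom \<Gamma> (sym_group (n l))"
      and tv: "\<And>Q. finite Q \<Longrightarrow> Q \<subseteq> carrier \<Gamma> \<Longrightarrow>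
        (\<lambda>l. tv_dist (Pow Q) (stab_distr (n l) (f l) Q) (stab_distr (n l) (g l) Q)) \<longlonglongrightarrow> 0"
      by blast
    obtain \<epsilon> N h where "\<And>l. 0 < \<epsilon> l" "\<epsilon> \<longlonglongrightarrow> 0" "\<And>l. h l \<in> hom \<Gamma> (sym_group (N l))"
      "\<And>l. n l \<le> N l" "\<And>l. enat (N l) \<le> enat (n l) + \<nu> (\<epsilon> l) (n l)"
      "\<And>\<gamma>. \<gamma> \<in> carrier \<Gamma> \<Longrightarrow> (\<lambda>l. perm_dist (n l) (f l \<gamma>) (h l \<gamma>)) \<longlonglongrightarrow> 0"
      by (rule near_homs_if_rigid[OF assms(1) rigid n[rule_format] f[rule_format]
            almost[rule_format] g tv]) blast+
    then show "\<exists>\<epsilon> N h. (\<forall>l. 0 < \<epsilon> l) \<and> \<epsilon> \<longlonglongrightarrow> 0 \<and> (\<forall>l. h l \<in> hom \<Gamma> (sym_group (N l))) \<and>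
      (\<forall>l. n l \<le> N l \<and> enat (N l) \<le> enat (n l) + \<nu> (\<epsilon> l) (n l)) \<and>
      (\<forall>\<gamma>\<in>carrier \<Gamma>. (\<lambda>l. perm_dist (n l) (f l \<gamma>) (h l \<gamma>)) \<longlonglongrightarrow> 0)"
      by (intro exI conjI allI ballI)
  next
    assume stable: ?stable
    show ?rigid
    proof (rule ccontr)
      assume "\<not> ?rigid"
      then obtain \<epsilon>\<^sub>0 n \<sigma> and f g :: "nat \<Rightarrow> 's fword set \<Rightarrow> nat \<Rightarrow> nat"
        where \<epsilon>\<^sub>0: "0 < \<epsilon>\<^sub>0" and n: "\<And>l. 1 \<le> n l" "filterlim n at_top sequentially"
          and far: "\<And>l. \<sigma> l \<in> Sol_far \<nu> S E \<epsilon>\<^sub>0 (n l)"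
          and \<sigma>f: "\<And>s. s \<in> S \<Longrightarrow> (\<lambda>l. perm_dist (n l) (\<sigma> l s) (f l (proj [(s, True)]))) \<longlonglongrightarrow> 0"
          and f: "\<And>l. f l \<in> carrier \<Gamma> \<rightarrow> carrier (sym_group (n l))"
            "\<And>\<gamma> \<delta>. \<gamma> \<in> carrier \<Gamma> \<Longrightarrow> \<delta> \<in> carrier \<Gamma> \<Longrightarrow>
              (\<lambda>l. perm_dist (n l) (f l (\<gamma> \<otimes>\<^bsub>\<Gamma>\<^esub> \<delta>)) (f l \<gamma> \<otimes>\<^bsub>sym_group (n l)\<^esub> f l \<delta>)) \<longlonglongrightarrow> 0"
          and g: "\<And>l. g l \<in> hom \<Gamma> (sym_group (n l))"
            "\<And>Q. finite Q \<Longrightarrow> Q \<subseteq> carrier \<Gamma> \<Longrightarrow>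
              (\<lambda>l. tv_dist (Pow Q) (stab_distr (n l) (f l) Q) (stab_distr (n l) (g l) Q)) \<longlonglongrightarrow> 0"
        by (rule almost_hom_if_not_rigid[OF assms(1)]) blast
      have "\<exists>g. (\<forall>l. g l \<in> hom \<Gamma> (sym_group (n l))) \<and> (\<forall>Q. finite Q \<and> Q \<subseteq> carrier \<Gamma> \<longrightarrow>
          (\<lambda>l. tv_dist (Pow Q) (stab_distr (n l) (f l) Q) (stab_distr (n l) (g l) Q)) \<longlonglongrightarrow> 0)"
        using g by blast
      from stable[rule_format, OF n(1) f(1) n(2) f(2) this, simplified]
      obtain \<epsilon> N h where \<epsilon>: "\<And>l. 0 < \<epsilon> l" "\<epsilon> \<longlonglongrightarrow> 0"
        and h: "\<And>l. h l \<in> hom \<Gamma> (sym_group (N l))"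
        and N: "\<And>l. n l \<le> N l" "\<And>l. enat (N l) \<le> enat (n l) + \<nu> (\<epsilon> l) (n l)"
        and fh: "\<And>\<gamma>. \<gamma> \<in> carrier \<Gamma> \<Longrightarrow> (\<lambda>l. perm_dist (n l) (f l \<gamma>) (h l \<gamma>)) \<longlonglongrightarrow> 0"
        by blast
      \<comment> \<open>A solution of degree \<open>N l\<close>, which will contradict that
        \<open>\<sigma> l\<close> is far from all admissible ones.\<close>
      define \<tau> where "\<tau> l = (\<lambda>s\<in>S. h l (proj [(s, True)]))" for l
      have "(\<lambda>l. \<Sum>s\<in>S. perm_dist (n l) (\<sigma> l s) (\<tau> l s)) \<longlonglongrightarrow> (\<Sum>s\<in>S. 0)"
      proof (rule tendsto_sum)
        fix s assume s: "s \<in> S"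
        let ?\<gamma> = "proj [(s, True)]"
        have "?\<gamma> \<in> carrier \<Gamma>"
          using gen_carrier[OF s] by simp
        \<comment> \<open>On each generator \<open>f l\<close> is the intermediate point between
          \<open>\<sigma> l\<close> and \<open>h l\<close>.\<close>
        from tendsto_add[OF \<sigma>f[OF s] fh[OF this]]
        have "(\<lambda>l. perm_dist (n l) (\<sigma> l s) (f l ?\<gamma>) + perm_dist (n l) (f l ?\<gamma>) (h l ?\<gamma>)) \<longlonglongrightarrow> 0"
          by simp
        then show "(\<lambda>l. perm_dist (n l) (\<sigma> l s) (\<tau> l s)) \<longlonglongrightarrow> 0"
          by (rule perm_dist_tendsto_0) (use s in \<open>simp add: \<tau>_def perm_dist_triangle\<close>)
      qed
      then have "\<forall>\<^sub>F l in sequentially. (\<Sum>s\<in>S. perm_dist (n l) (\<sigma> l s) (\<tau> l s)) < \<epsilon>\<^sub>0"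
        using \<epsilon>\<^sub>0 by (intro order_tendstoD(2)) auto
      with order_tendstoD(2)[OF \<epsilon>(2) \<epsilon>\<^sub>0] have "\<forall>\<^sub>F l in sequentially. False"
      proof eventually_elim
        case (elim l)
        \<comment> \<open>Monotonicity of \<open>\<nu>\<close> enters here: once
          \<open>\<epsilon> l < \<epsilon>\<^sub>0\<close>, the degree \<open>N l\<close> is
          admissible for the fixed \<open>\<epsilon>\<^sub>0\<close> as well.\<close>
        have "\<nu> (\<epsilon> l) (n l) \<le> \<nu> \<epsilon>\<^sub>0 (n l)"
          using \<epsilon>(1) elim n(1) by (intro assms(3)) auto
        then have "enat (N l) \<le> enat (n l) + \<nu> \<epsilon>\<^sub>0 (n l)"
          using N(2)[of l] by (meson add_left_mono order_trans)
        moreover have "\<tau> l \<in> Sol S E (N l)"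
          unfolding \<tau>_def by (rule Sol_hom[OF h])
        ultimately have "\<sigma> l \<in> Sol_near \<nu> S E \<epsilon>\<^sub>0 (n l)"
          using far[of l] N(1)[of l] elim by (auto simp: Sol_near_def Sol_far_def)
        with far[of l] show False
          by (simp add: Sol_far_def)
      qed
      then show False by simp
    qed
  qed
qed

end
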